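(* Let the state space be $S=\mathbb R$ or $S=\mathbb Z$, and let the single-particle process satisfy the Karlin–McGregor assumptions (KM1)–(KM4). Let $n$ coalescing particles start at $x_1\le\cdots\le x_n$ and run until time $T>0$. Fix a coalescence pattern, i.e. a composition $c_1+\cdots+c_k=n$ (the first $c_1$ particles merge into survivor $1$, the next $c_2$ into survivor $2$, and so on; survivors are labelled in increasing spatial order). Let $W_k=\{(y_1,\dots,y_k)\in S^k: y_1<\cdots<y_k\}$. For $(y_1,\dots,y_k)\in W_k$ let $\tilde M=\tilde M(y_1,\dots,y_k)$ be the $n\times n$ matrix whose entry in row $i$ and column $j$, where $j$ lies in the $l$-th block of the composition (indices $c_1+\cdots+c_{l-1}+1$ through $c_1+\cdots+c_l$), is $$\tilde M_{ij}=\begin{cases}p_{x_i}(y_l) & \text{if } j \text{ is the first index in its block},\\ F_{x_i}(y_l)-[i<j] & \text{otherwise},\end{cases}$$ with $[i<j]$ the Iverson bracket. Then for every measurable $A\subseteq W_k$, $$\mathbb P_{\mathrm{int}}(\text{survivor positions}\in A)=\int_A\det\bigl(\tilde M(y_1,\dots,y_k)\bigr)\,d\nu^{\otimes k},$$ where the left-hand side is the probability, for the coalescing system, that the coalescence pattern at time $T$ is the given composition and the survivor positions $(y_1,\dots,y_k)$ lie in $A$.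
   Context: Transition kernels: $P_x$ is the law of the position $X_T$ of a single particle started at $x$; $\nu$ is Lebesgue measure on $\mathbb R$ or counting measure on $\mathbb Z$; $p_x$ is the density of $P_x$ with respect to $\nu$ (assumed to exist; automatic on $\mathbb Z$); $F_x(y)=P_x((-\infty,y])$. Karlin–McGregor assumptions for the system of $n$ non-interacting particles $(X^1_t,\dots,X^n_t)_{0\le t\le T}$ started at $x_1\le\dots\le x_n$: (KM1) the $n$-particle system is strong Markov: for any stopping time $\tau$ of its joint filtration, the post-$\tau$ system is conditionally independent of the pre-$\tau$ system given the state at $\tau$; (KM2) the particles are independent and all follow the same Markov process, differing only in initial position; (KM3) adjacent particles cannot change their relative order without first occupying the same state; (KM4) for particles $I<J$ the first meeting time $\tau_{I,J}=\inf\{t:X^I_t=X^J_t\}$ is a stopping time. Coalescing system: fix a priority order on the particles and run the $n$ non-interacting trajectories. Initially all particles are active, particle $j$ carrying the cluster $\{j\}$. At the first instant at which two active particles occupy a common state (possibly time $0$), their clusters merge; the higher-priority particle stays active, carries the merged cluster and continues along its own trajectory, and the lower-priority one ceases to be active (it is a "ghost" and no longer interacts). Repeat with the active particles; meetings of three or more active particles at one instant are resolved as successive binary collisions in priority order. $\mathbb P_{\mathrm{int}}$ is the law of the resulting system; it does not depend on the priority order. The survivors are the particles active at time $T$; their clusters are consecutive blocks of $\{1,\dots,n\}$, whose sizes in order form the coalescence pattern (a composition of $n$). *)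

theory Defs
  imports "HOL-Probability.Probability" "Jordan_Normal_Form.Determinant"
begin

text \<open>
  The state space \<open>S\<close> is carried by its reference measure \<open>\<nu>\<close>: it is \<open>space \<nu>\<close>, where
  \<open>\<nu> = lborel\<close> for \<open>S = \<real>\<close>, and \<open>\<nu> = count_space \<int>\<close> for \<open>S = \<int>\<close>, the integers being
  regarded as real numbers. Particles are numbered from \<open>0\<close>. A trajectory is observed at real times
  in \<open>{0..T}\<close>, whereas random times have values in \<^typ>\<open>ennreal\<close>, with \<open>\<infinity>\<close> for "never".
\<close>

text \<open>
  \<open>K s t z\<close> is the law at time \<open>t\<close> of the process that is in state \<open>z\<close> at time \<open>s\<close>; homogeneity
  in time is not required.
\<close>

definition transition_kernels ::
    "'s measure \<Rightarrow> real \<Rightarrow> (real \<Rightarrow> real \<Rightarrow> 's \<Rightarrow> 's measure) \<Rightarrow> bool" where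
  "transition_kernels N T K \<longleftrightarrow>
     (\<forall>s t. 0 \<le> s \<and> s \<le> t \<and> t \<le> T \<longrightarrow> K s t \<in> N \<rightarrow>\<^sub>M prob_algebra N) \<and>
     (\<forall>s. 0 \<le> s \<and> s \<le> T \<longrightarrow> (\<forall>z\<in>space N. K s s z = return N z)) \<and>
     (\<forall>r s t. 0 \<le> r \<and> r \<le> s \<and> s \<le> t \<and> t \<le> T \<longrightarrow>
        (\<forall>z\<in>space N. K r t z = K r s z \<bind> K s t))"

definition natural_filtration ::
    "'w measure \<Rightarrow> 's measure \<Rightarrow> real \<Rightarrow> (real \<Rightarrow> 'w \<Rightarrow> 's) \<Rightarrow> ennreal \<Rightarrow> 'w measure" where
  "natural_filtration M N T Y t =
     sigma (space M) {Y s -` B \<inter> space M | s B. s \<in> {0..T} \<and> ennreal s \<le> t \<and> B \<in> sets N}"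

definition markov_process ::
    "'w measure \<Rightarrow> 's measure \<Rightarrow> real \<Rightarrow> (real \<Rightarrow> real \<Rightarrow> 's \<Rightarrow> 's measure) \<Rightarrow>
     (real \<Rightarrow> 'w \<Rightarrow> 's) \<Rightarrow> bool" where
  "markov_process M N T K Y \<longleftrightarrow>
     (\<forall>t\<in>{0..T}. Y t \<in> M \<rightarrow>\<^sub>M N) \<and>
     (\<forall>s t. 0 \<le> s \<and> s \<le> t \<and> t \<le> T \<longrightarrow> (\<forall>B\<in>sets N.
        AE \<omega> in M. real_cond_exp M (natural_filtration M N T Y (ennreal s))
                     (indicator {\<omega>\<in>space M. Y t \<omega> \<in> B}) \<omega>
                   = measure (K s t (Y s \<omega>)) B))"

text \<open>
  The strong Markov property: given the past up to a stopping time \<open>\<tau>\<close>, the process after \<open>\<tau>\<close> is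
  the Markov process with kernels \<open>K\<close> started at time \<open>\<tau>\<close> from the state \<open>Y \<tau>\<close>; in particular it
  depends on that past only through \<open>\<tau>\<close> and \<open>Y \<tau>\<close>. Only one-dimensional distributions after \<open>\<tau>\<close>
  are mentioned: those at several times \<open>\<tau> \<le> t\<^sub>1 \<le> t\<^sub>2 \<le> \<dots>\<close> follow, since the constant times
  \<open>t\<^sub>1, t\<^sub>2, \<dots>\<close> are themselves stopping times.
\<close>

definition strong_markov ::
    "'w measure \<Rightarrow> 's measure \<Rightarrow> real \<Rightarrow> (real \<Rightarrow> real \<Rightarrow> 's \<Rightarrow> 's measure) \<Rightarrow>
     (real \<Rightarrow> 'w \<Rightarrow> 's) \<Rightarrow> bool" where
  "strong_markov M N T K Y \<longleftrightarrow>
     (\<forall>\<tau>. stopping_time (natural_filtration M N T Y) \<tau> \<longrightarrow> (\<forall>t\<in>{0..T}. \<forall>B\<in>sets N.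
        AE \<omega> in M. \<tau> \<omega> \<le> ennreal t \<longrightarrow>
          real_cond_exp M (filtration.pre_sigma (space M) (natural_filtration M N T Y) \<tau>)
            (indicator {\<omega>\<in>space M. Y t \<omega> \<in> B}) \<omega>
          = measure (K (enn2real (\<tau> \<omega>)) t (Y (enn2real (\<tau> \<omega>)) \<omega>)) B))"

definition joint :: "nat \<Rightarrow> (nat \<Rightarrow> real \<Rightarrow> 'w \<Rightarrow> real) \<Rightarrow> real \<Rightarrow> 'w \<Rightarrow> nat \<Rightarrow> real" where
  "joint n X t \<omega> = (\<lambda>i\<in>{..<n}. X i t \<omega>)"

abbreviation joint_space :: "nat \<Rightarrow> real measure \<Rightarrow> (nat \<Rightarrow> real) measure" where
  "joint_space n \<nu> \<equiv> PiM {..<n} (\<lambda>_. \<nu>)"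

definition joint_kernels ::
    "nat \<Rightarrow> (real \<Rightarrow> real \<Rightarrow> real \<Rightarrow> real measure) \<Rightarrow>
     real \<Rightarrow> real \<Rightarrow> (nat \<Rightarrow> real) \<Rightarrow> (nat \<Rightarrow> real) measure" where
  "joint_kernels n K s t z = PiM {..<n} (\<lambda>i. K s t (z i))"

definition meeting_time ::
    "real \<Rightarrow> (nat \<Rightarrow> real \<Rightarrow> 'w \<Rightarrow> real) \<Rightarrow> nat \<Rightarrow> nat \<Rightarrow> 'w \<Rightarrow> ennreal" where
  "meeting_time T X I J \<omega> = Inf {ennreal t | t. t \<in> {0..T} \<and> X I t \<omega> = X J t \<omega>}"

definition KM1 ::
    "'w measure \<Rightarrow> real measure \<Rightarrow> real \<Rightarrow> nat \<Rightarrow> (real \<Rightarrow> real \<Rightarrow> real \<Rightarrow> real measure) \<Rightarrow>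
     (nat \<Rightarrow> real \<Rightarrow> 'w \<Rightarrow> real) \<Rightarrow> bool" where
  "KM1 M \<nu> T n K X \<longleftrightarrow> strong_markov M (joint_space n \<nu>) T (joint_kernels n K) (joint n X)"

definition KM2 ::
    "'w measure \<Rightarrow> real measure \<Rightarrow> real \<Rightarrow> nat \<Rightarrow> (real \<Rightarrow> real \<Rightarrow> real \<Rightarrow> real measure) \<Rightarrow>
     (nat \<Rightarrow> real) \<Rightarrow> (nat \<Rightarrow> real \<Rightarrow> 'w \<Rightarrow> real) \<Rightarrow> bool" where
  "KM2 M \<nu> T n K x X \<longleftrightarrow>
     prob_space.indep_vars M (\<lambda>_. PiM {0..T} (\<lambda>_. \<nu>)) (\<lambda>i \<omega>. \<lambda>t\<in>{0..T}. X i t \<omega>) {..<n} \<and>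
     (\<forall>i<n. markov_process M \<nu> T K (X i) \<and> (AE \<omega> in M. X i 0 \<omega> = x i))"

text \<open>
  Particles \<open>I < J\<close> that become adjacent only when the particles between them cease to be active
  have to keep their order as well, whence all pairs: \<open>I\<close> and \<open>J\<close> are adjacent in the two-particle
  system they form.
\<close>

definition KM3 ::
    "'w measure \<Rightarrow> real \<Rightarrow> nat \<Rightarrow> (nat \<Rightarrow> real \<Rightarrow> 'w \<Rightarrow> real) \<Rightarrow> bool" where
  "KM3 M T n X \<longleftrightarrow>
     (\<forall>I J. I < J \<and> J < n \<longrightarrow>
        (AE \<omega> in M. \<forall>t\<in>{0..T}. (\<forall>s\<in>{0..t}. X I s \<omega> \<noteq> X J s \<omega>) \<longrightarrow> X I t \<omega> < X J t \<omega>))"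

text \<open>
  A \<^emph>\<open>first\<close> meeting time is a time of meeting: the infimum is attained unless the two particles
  never meet. This is automatic for right-continuous trajectories.
\<close>

definition KM4 ::
    "'w measure \<Rightarrow> real measure \<Rightarrow> real \<Rightarrow> nat \<Rightarrow> (nat \<Rightarrow> real \<Rightarrow> 'w \<Rightarrow> real) \<Rightarrow> bool" where
  "KM4 M \<nu> T n X \<longleftrightarrow>
     (\<forall>I J. I < J \<and> J < n \<longrightarrow>
        stopping_time (natural_filtration M (joint_space n \<nu>) T (joint n X)) (meeting_time T X I J) \<and>
        (AE \<omega> in M. meeting_time T X I J \<omega> \<noteq> \<infinity> \<longrightarrow>
           X I (enn2real (meeting_time T X I J \<omega>)) \<omega> = X J (enn2real (meeting_time T X I J \<omega>)) \<omega>))"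

text \<open>
  The clusters are described by a function \<open>own\<close>: particle \<open>own j\<close> is the active particle whose
  cluster contains \<open>j\<close>. The set of active particles is \<open>own ` {..<n}\<close>. Particle \<open>I\<close> has higher priority
  than \<open>J\<close> if \<open>pr I < pr J\<close>.

  Two active particles have not met before, so the next collision is at the least meeting time of
  two active particles. A collision is a pair \<open>(winner, loser)\<close>.
\<close>

definition next_collisions ::
    "real \<Rightarrow> nat \<Rightarrow> (nat \<Rightarrow> nat) \<Rightarrow> (nat \<Rightarrow> real \<Rightarrow> 'w \<Rightarrow> real) \<Rightarrow> 'w \<Rightarrow> (nat \<Rightarrow> nat) \<Rightarrow> (nat \<times> nat) set"
  where
  "next_collisions T n pr X \<omega> own =
     {(I, J). I \<in> own ` {..<n} \<and> J \<in> own ` {..<n} \<and> pr I < pr J \<and>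
        meeting_time T X I J \<omega> \<noteq> \<infinity> \<and>
        (\<forall>I'\<in>own ` {..<n}. \<forall>J'\<in>own ` {..<n}. I' \<noteq> J' \<longrightarrow>
           meeting_time T X I J \<omega> \<le> meeting_time T X I' J' \<omega>)}"

definition collide ::
    "real \<Rightarrow> nat \<Rightarrow> (nat \<Rightarrow> nat) \<Rightarrow> (nat \<Rightarrow> real \<Rightarrow> 'w \<Rightarrow> real) \<Rightarrow> 'w \<Rightarrow> (nat \<Rightarrow> nat) \<Rightarrow> nat \<Rightarrow> nat" where
  "collide T n pr X \<omega> own =
     (let C = next_collisions T n pr X \<omega> own in
      if C = {} then own
      else let I = arg_min_on pr (fst ` C); J = arg_min_on pr {J. (I, J) \<in> C}
           in (\<lambda>j. if own j = J then I else own j))"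

text \<open>Each collision deactivates a particle, so there are fewer than \<open>n\<close> collisions, if \<open>n > 0\<close>.\<close>

definition final_own ::
    "real \<Rightarrow> nat \<Rightarrow> (nat \<Rightarrow> nat) \<Rightarrow> (nat \<Rightarrow> real \<Rightarrow> 'w \<Rightarrow> real) \<Rightarrow> 'w \<Rightarrow> nat \<Rightarrow> nat" where
  "final_own T n pr X \<omega> = (collide T n pr X \<omega> ^^ n) id"

definition survivors ::
    "real \<Rightarrow> nat \<Rightarrow> (nat \<Rightarrow> nat) \<Rightarrow> (nat \<Rightarrow> real \<Rightarrow> 'w \<Rightarrow> real) \<Rightarrow> 'w \<Rightarrow> nat list" where
  "survivors T n pr X \<omega> =
     sort_key (\<lambda>I. X I T \<omega>) (sorted_list_of_set (final_own T n pr X \<omega> ` {..<n}))"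

definition coalescence_pattern ::
    "real \<Rightarrow> nat \<Rightarrow> (nat \<Rightarrow> nat) \<Rightarrow> (nat \<Rightarrow> real \<Rightarrow> 'w \<Rightarrow> real) \<Rightarrow> 'w \<Rightarrow> nat list" where
  "coalescence_pattern T n pr X \<omega> =
     map (\<lambda>I. card {j\<in>{..<n}. final_own T n pr X \<omega> j = I}) (survivors T n pr X \<omega>)"

definition survivor_positions ::
    "real \<Rightarrow> nat \<Rightarrow> (nat \<Rightarrow> nat) \<Rightarrow> (nat \<Rightarrow> real \<Rightarrow> 'w \<Rightarrow> real) \<Rightarrow> 'w \<Rightarrow> nat \<Rightarrow> real" where
  "survivor_positions T n pr X \<omega> =
     (\<lambda>l\<in>{..<length (survivors T n pr X \<omega>)}. X (survivors T n pr X \<omega> ! l) T \<omega>)"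

definition is_composition :: "nat list \<Rightarrow> nat \<Rightarrow> bool" where
  "is_composition c n \<longleftrightarrow> sum_list c = n \<and> (\<forall>m\<in>set c. 0 < m)"

definition block_start :: "nat list \<Rightarrow> nat \<Rightarrow> nat" where
  "block_start c l = sum_list (take l c)"

definition block_of :: "nat list \<Rightarrow> nat \<Rightarrow> nat" where
  "block_of c j = (THE l. l < length c \<and> block_start c l \<le> j \<and> j < block_start c (Suc l))"

definition weyl_chamber :: "real measure \<Rightarrow> nat \<Rightarrow> (nat \<Rightarrow> real) set" where
  "weyl_chamber \<nu> k = {y \<in> {..<k} \<rightarrow>\<^sub>E space \<nu>. \<forall>l m. l < m \<and> m < k \<longrightarrow> y l < y m}"

text \<open>
  \<open>P z\<close> is the law at time \<open>T\<close> of a particle started at \<open>z\<close>, and \<open>p z\<close> is its density with respect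
  to \<open>\<nu>\<close>. In \<open>dist_fun\<close> the ray is cut down to \<open>space \<nu>\<close>: for \<open>\<nu> = count_space \<int>\<close> the set \<open>{..y}\<close>
  itself is not measurable and would get measure \<open>0\<close>.
\<close>

definition dist_fun :: "real measure \<Rightarrow> (real \<Rightarrow> real measure) \<Rightarrow> real \<Rightarrow> real \<Rightarrow> real" where
  "dist_fun \<nu> P z y = measure (P z) {u \<in> space \<nu>. u \<le> y}"

definition coalescence_matrix ::
    "real measure \<Rightarrow> (real \<Rightarrow> real measure) \<Rightarrow> (real \<Rightarrow> real \<Rightarrow> real) \<Rightarrow> nat \<Rightarrow> nat list \<Rightarrow>
     (nat \<Rightarrow> real) \<Rightarrow> (nat \<Rightarrow> real) \<Rightarrow> real mat" where
  "coalescence_matrix \<nu> P p n c x y =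
     mat n n (\<lambda>(i, j). let l = block_of c j in
       if j = block_start c l then p (x i) (y l)
       else dist_fun \<nu> P (x i) (y l) - of_bool (i < j))"

end

theory Submission
  imports Defs
begin

text \<open>
  The determinant is the expectation of a signed sum over the permutations \<open>\<tau>\<close> of the positions of
  the non-interacting particles at time \<open>T\<close> (\<open>coalescence_sum\<close>; column \<open>j\<close> is served by particle
  \<open>\<tau> j\<close>). In this sum replace the position of every particle by the position of the owner of its
  cluster. When two clusters merge, the two owners are at the same place, and by the strong Markov
  property the conditional expectation of the sum does not change: after expanding the factors
  \<open>[\<dots> \<le> y] - [i < j]\<close>, all terms in which two columns are served by particles with the same
  owner cancel by an exchange of these columns, and the remaining terms depend on the owners only
  through their positions at the time of the collision. So the expectation is the same at the end as
  at the beginning. At the end the positions of the owners form a nondecreasing sequence, for which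
  only the identity permutation contributes, and its contribution is the indicator of the event that
  the clusters are the blocks of the composition and the survivors are in \<open>A\<close>.
\<close>

section \<open>Compositions and the signed sum\<close>

text \<open>The Markov property describes the future by a product measure over distinct particles. A
  term with two columns served by one owner reads the same trajectory twice and is not covered, so
  it has to be cancelled before conditioning. The permutations that remain depend on the owner map,
  so the sums before and after a collision have different ranges. The cancellation is therefore run
  backwards: each conditioned term is the probability of an event for independent columns, which
  makes sense for shared owners too, and antisymmetry adds the missing permutations back. Both sums
  then run over all permutations and see the owner map only through the owners' positions. The
  expansion of the tail factors is forced by \<open>[i < j]\<close>: this bracket depends on the
  column, so the unexpanded product is not antisymmetric under exchange of columns. Simultaneous
  collisions are the second obstacle: priority may merge particles that are not neighbours first,
  which makes the owner map temporarily non-monotone. Every inversion, however, is a pair that meets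
  at the current collision time, so none is left once no collision is pending.\<close>

lemma block_start_0 [simp]: "block_start c 0 = 0"
  by (simp add: block_start_def)

lemma block_start_Suc: "l < length c \<Longrightarrow> block_start c (Suc l) = block_start c l + c ! l"
  by (simp add: block_start_def take_Suc_conv_app_nth)

locale composition =
  fixes c :: "nat list" and n :: nat
  assumes comp: "is_composition c n"
begin

abbreviation k :: nat where "k \<equiv> length c"
abbreviation start :: "nat \<Rightarrow> nat" where "start \<equiv> block_start c"
abbreviation head :: "nat \<Rightarrow> nat" where "head j \<equiv> block_start c (block_of c j)"

lemma start_length: "start k = n"
  using comp by (simp add: block_start_def is_composition_def)

lemma start_less: "l < m \<Longrightarrow> m \<le> k \<Longrightarrow> start l < start m"
proof (induction m)
  case (Suc m)
  have "0 < c ! m" using comp Suc.prems by (auto simp: is_composition_def)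
  then show ?case using Suc block_start_Suc[of m c] by (cases "l = m") auto
qed simp

lemma start_le: "l \<le> m \<Longrightarrow> m \<le> k \<Longrightarrow> start l \<le> start m"
  using start_less[of l m] by (cases "l = m") auto

lemma start_less_n: "l < k \<Longrightarrow> start l < n"
  using start_less[of l k] start_length by simp

lemma block_of_eqI: "l < k \<Longrightarrow> start l \<le> j \<Longrightarrow> j < start (Suc l) \<Longrightarrow> block_of c j = l"
  unfolding block_of_def
proof (rule the_equality)
  fix m assume l: "l < k" "start l \<le> j" "j < start (Suc l)"
    and m: "m < k \<and> start m \<le> j \<and> j < start (Suc m)"
  have "\<not> m < l" using start_le[of "Suc m" l] l m by auto
  moreover have "\<not> l < m" using start_le[of "Suc l" m] l m by auto
  ultimately show "m = l" by simp
qed auto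

lemma ex_block: "j < n \<Longrightarrow> \<exists>l<k. start l \<le> j \<and> j < start (Suc l)"
proof -
  assume j: "j < n"
  have "j < start m \<Longrightarrow> m \<le> k \<Longrightarrow> \<exists>l<k. start l \<le> j \<and> j < start (Suc l)" for m
  proof (induction m)
    case (Suc m)
    then show ?case by (cases "j < start m") (auto intro: exI[of _ m])
  qed simp
  from this[of k] j start_length show ?thesis by simp
qed

lemma block_of:
  assumes "j < n"
  shows "block_of c j < k" "head j \<le> j" "j < start (Suc (block_of c j))"
  using ex_block[OF assms] block_of_eqI by auto

lemma block_of_start [simp]: "l < k \<Longrightarrow> block_of c (start l) = l"
  by (rule block_of_eqI) (auto simp: start_less)

lemma head_less_n: "j < n \<Longrightarrow> head j < n"
  using block_of start_less_n by blast

text \<open>Heads are the columns of \<open>coalescence_matrix\<close> that carry densities, tails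
  those that carry distribution functions.\<close>

definition heads :: "nat set" where "heads = start ` {..<k}"
definition tails :: "nat set" where "tails = {j. j < n \<and> head j \<noteq> j}"

lemma heads_eq: "heads = {j. j < n \<and> head j = j}"
  unfolding heads_def using start_less_n block_of(1) by force

lemma heads_tails: "heads \<inter> tails = {}" "heads \<union> tails = {..<n}"
  by (auto simp: heads_eq tails_def)

lemma inj_start: "inj_on start {..<k}"
  by (rule linorder_inj_onI) (auto dest: start_less)

lemma finite_heads_tails [simp]: "finite heads" "finite tails"
  by (auto simp: heads_def tails_def)

lemma heads_subset: "heads \<subseteq> {..<n}" and tails_subset: "tails \<subseteq> {..<n}"
  using heads_tails by auto

lemma head_in_heads: "j < n \<Longrightarrow> head j \<in> heads"
  by (auto simp: heads_def block_of)

end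

text \<open>This is the Leibniz expansion of the determinant before integration: the density columns
  become the indicator of \<open>A\<close> at the head positions, and a distribution function
  becomes a comparison with the head of the block. Row \<open>i\<close> of column \<open>j\<close>
  is \<open>i = \<tau> j\<close>, so the bracket \<open>[i < j]\<close> reads
  \<open>\<tau> j < j\<close>.\<close>

definition coalescence_sum :: "nat \<Rightarrow> nat list \<Rightarrow> (nat \<Rightarrow> real) set \<Rightarrow> (nat \<Rightarrow> real) \<Rightarrow> real" where
  "coalescence_sum n c A w =
     (\<Sum>\<tau> | \<tau> permutes {..<n}. signof \<tau> * indicator A (\<lambda>l\<in>{..<length c}. w (\<tau> (block_start c l))) *
        (\<Prod>j\<in>composition.tails c n.
           of_bool (w (\<tau> j) \<le> w (\<tau> (block_start c (block_of c j)))) - of_bool (\<tau> j < j)))"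

context composition
begin

text \<open>A tail factor is nonzero only if exactly one of its two brackets holds. Hence
  \<open>\<tau>\<close> sends a tail \<open>j\<close> either to \<open>\<tau> j \<ge> j\<close> with
  a position weakly left of that of the head, or to \<open>\<tau> j < j\<close> with a position
  strictly right of it. If \<open>i\<close> were the least index moved by a contributing
  \<open>\<tau>\<close>, then \<open>i\<close> would be a tail with both brackets equal to zero. For
  the identity the factor is \<open>[w j \<le> w (head j)]\<close>, and monotonicity turns the
  inequality into an equality.\<close>

lemma coalescence_sum_mono:
  assumes A: "A \<subseteq> weyl_chamber \<nu> k"
    and mono: "\<And>i j. i \<le> j \<Longrightarrow> j < n \<Longrightarrow> w i \<le> w j"
  shows "coalescence_sum n c A w =
    of_bool ((\<lambda>l\<in>{..<k}. w (start l)) \<in> A \<and> (\<forall>j<n. w j = w (head j)))"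
proof -
  define f :: "(nat \<Rightarrow> nat) \<Rightarrow> real" where "f \<tau> = signof \<tau> * indicator A (\<lambda>l\<in>{..<k}. w (\<tau> (start l))) *
        (\<Prod>j\<in>tails. of_bool (w (\<tau> j) \<le> w (\<tau> (head j))) - of_bool (\<tau> j < j))" for \<tau>
  have "f \<tau> = 0" if \<tau>: "\<tau> permutes {..<n}" and ne: "\<tau> \<noteq> id" for \<tau>
  proof (rule ccontr)
    assume nz: "f \<tau> \<noteq> 0"
    have inA: "(\<lambda>l\<in>{..<k}. w (\<tau> (start l))) \<in> A"
      using nz by (force simp: f_def indicator_def)
    have incr: "w (\<tau> (start l)) < w (\<tau> (start m))" if "l < m" "m < k" for l m
      using inA A that by (auto simp: weyl_chamber_def dest!: subsetD)
    have fac: "of_bool (w (\<tau> j) \<le> w (\<tau> (head j))) - of_bool (\<tau> j < j) \<noteq> (0::real)" if "j \<in> tails" for j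
    proof
      assume zero: "of_bool (w (\<tau> j) \<le> w (\<tau> (head j))) - of_bool (\<tau> j < j) = (0::real)"
      then have "(\<Prod>j\<in>tails. of_bool (w (\<tau> j) \<le> w (\<tau> (head j))) - of_bool (\<tau> j < j)) = (0::real)"
        by - (rule prod_zero, rule finite_heads_tails, rule bexI[where x = j], rule zero, rule that)
      then show False using nz by (simp add: f_def)
    qed
    have "\<tau> i = i" if "i < n" for i
      using that
    proof (induction i rule: less_induct)
      case (less i)
      have IH: "\<And>i'. i' < i \<Longrightarrow> \<tau> i' = i'" using less by auto
      have ge: "i \<le> \<tau> i"
      proof (rule ccontr)
        assume less_i: "\<not> ?thesis"
        then have "\<tau> (\<tau> i) = \<tau> i" using IH by simp
        then have "\<tau> i = i" using permutes_inj[OF \<tau>] by (auto dest: injD)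
        then show False using less_i by simp
      qed
      have \<tau>i: "\<tau> i < n" using permutes_in_image[OF \<tau>, of i] less.prems by simp
      \<comment> \<open>Since \<open>i \<le> \<tau> i\<close>, the second bracket is zero, and
        \<open>w (\<tau> i) \<ge> w i\<close> makes the first one zero as well.\<close>
      have no_tail: False if "i \<in> tails" "w (\<tau> (head i)) < w i"
      proof -
        have "w i \<le> w (\<tau> i)" using mono ge \<tau>i by blast
        then show False using fac[OF that(1)] that(2) ge by auto
      qed
      obtain j where \<tau>j: "\<tau> j = i"
        using permutes_surj[OF \<tau>] by (metis surjD)
      have jn: "j < n" using \<tau>j less.prems permutes_in_image[OF \<tau>, of j] by simp
      have ji: "i \<le> j"
        using IH[of j] \<tau>j by force
      have "j = i"
      proof (rule ccontr)
        assume "j \<noteq> i"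
        with ji have ij: "i < j" by simp
        show False
        proof (cases "j \<in> tails")
          case True
          \<comment> \<open>The bracket \<open>[\<tau> j < j]\<close> is one here, so the other must
            vanish. By monotonicity \<open>\<tau> (head j)\<close> is then below \<open>i\<close>,
            hence already known to be fixed, so \<open>head j < i < j\<close> and \<open>i\<close>
            is a tail of the block of \<open>j\<close>.\<close>
          have lt: "w (\<tau> (head j)) < w i"
            using fac[OF True] \<tau>j ij by (auto split: if_splits)
          have less_i: "\<not> i \<le> \<tau> (head j)"
            using lt mono[of i "\<tau> (head j)"] permutes_in_image[OF \<tau>, of "head j"] head_less_n[OF jn]
            by auto
          then have "\<tau> (\<tau> (head j)) = \<tau> (head j)" using IH by simp
          then have hj: "\<tau> (head j) = head j" using permutes_inj[OF \<tau>] by (auto dest: injD)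
          then have "head j < i" using less_i by simp
          then have "block_of c i = block_of c j"
            using block_of[OF jn] ij by (intro block_of_eqI) auto
          then show False
            using no_tail lt \<open>head j < i\<close> less.prems by (auto simp: tails_def)
        next
          case False
          then have hj: "head j = j" using jn by (simp add: tails_def)
          \<comment> \<open>Now \<open>i\<close> is the position index of a later head, and the
            strict increase of the head positions places the head of the block of \<open>i\<close>
            strictly left of \<open>w i\<close>.\<close>
          have bl: "block_of c i < block_of c j"
          proof (rule ccontr)
            assume "\<not> ?thesis"
            then have "start (block_of c j) \<le> start (block_of c i)"
              using block_of[OF less.prems] by (intro start_le) auto
            then show False using hj block_of[OF less.prems] ij by simp
          qed
          have lt: "w (\<tau> (head i)) < w i"
            using incr[OF bl block_of(1)[OF jn]] hj \<tau>j by simp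
          have "\<not> i \<le> \<tau> (head i)"
            using lt mono[of i "\<tau> (head i)"] permutes_in_image[OF \<tau>, of "head i"]
              head_less_n[OF less.prems] by auto
          then have "head i \<noteq> i" using ge by auto
          then show False using no_tail lt less.prems by (auto simp: tails_def)
        qed
      qed
      then show ?case using \<tau>j by simp
    qed
    then have "\<tau> = id" using \<tau> by (auto simp: permutes_def fun_eq_iff)
    with ne show False by simp
  qed
  then have "coalescence_sum n c A w = (\<Sum>\<tau>\<in>{id}. f \<tau>)"
    unfolding coalescence_sum_def f_def[symmetric]
    by (intro sum.mono_neutral_right) (auto simp: finite_permutations permutes_id)
  also have "\<dots> = indicator A (\<lambda>l\<in>{..<k}. w (start l)) * (\<Prod>j\<in>tails. of_bool (w j \<le> w (head j)))"
    by (simp add: f_def)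
  also have "(\<Prod>j\<in>tails. of_bool (w j \<le> w (head j))) = (of_bool (\<forall>j\<in>tails. w j \<le> w (head j)) :: real)"
  proof (cases "\<forall>j\<in>tails. w j \<le> w (head j)")
    case False
    then show ?thesis by (auto intro!: prod_zero)
  qed simp
  also have "(\<forall>j\<in>tails. w j \<le> w (head j)) \<longleftrightarrow> (\<forall>j<n. w j = w (head j))"
    using mono[OF block_of(2)] by (auto simp: tails_def intro!: antisym) (metis order_refl)
  finally show ?thesis by (simp only: indicator_def of_bool_conj)
qed

end

section \<open>Expansion of the signed sum\<close>

text \<open>The sign-reversing involution composes \<open>\<tau>\<close> with a transposition of two indices that
  \<open>own \<circ> \<tau>\<close> identifies; it leaves \<open>own \<circ> \<tau>\<close> unchanged, hence is well defined.\<close>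

lemma antisymmetric_sum_inj:
  fixes k :: "(nat \<Rightarrow> nat) \<Rightarrow> real" and \<phi> :: "(nat \<Rightarrow> 'a) \<Rightarrow> real"
  assumes U: "U \<subseteq> {..<n}"
    and anti: "\<And>\<tau> a b. \<tau> permutes {..<n} \<Longrightarrow> a \<in> U \<Longrightarrow> b \<in> U \<Longrightarrow> a \<noteq> b \<Longrightarrow>
      k (\<tau> \<circ> Transposition.transpose a b) = - k \<tau>"
  shows "(\<Sum>\<tau> | \<tau> permutes {..<n}. k \<tau> * \<phi> (own \<circ> \<tau>)) =
    (\<Sum>\<tau> | \<tau> permutes {..<n} \<and> inj_on (own \<circ> \<tau>) U. k \<tau> * \<phi> (own \<circ> \<tau>))"
proof -
  let ?N = "{\<tau>. \<tau> permutes {..<n} \<and> \<not> inj_on (own \<circ> \<tau>) U}"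
  \<comment> \<open>Here \<open>pr\<close> is a chosen pair of identified columns, unrelated to the
    priority order. It is a function of \<open>own \<circ> \<tau>\<close> alone, so a second
    application of \<open>\<iota>\<close> selects the same pair.\<close>
  define pr where "pr q = (SOME p. fst p \<in> U \<and> snd p \<in> U \<and> fst p \<noteq> snd p \<and> q (fst p) = q (snd p))"
    for q :: "nat \<Rightarrow> 'a"
  define \<iota> where "\<iota> \<tau> = \<tau> \<circ> Transposition.transpose (fst (pr (own \<circ> \<tau>))) (snd (pr (own \<circ> \<tau>)))" for \<tau>
  have pr: "fst (pr (own \<circ> \<tau>)) \<in> U" "snd (pr (own \<circ> \<tau>)) \<in> U"
      "fst (pr (own \<circ> \<tau>)) \<noteq> snd (pr (own \<circ> \<tau>))"
      "own (\<tau> (fst (pr (own \<circ> \<tau>)))) = own (\<tau> (snd (pr (own \<circ> \<tau>))))"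
    if \<tau>: "\<tau> \<in> ?N" for \<tau>
  proof -
    have "\<not> inj_on (own \<circ> \<tau>) U" using \<tau> by simp
    then have "\<exists>p. fst p \<in> U \<and> snd p \<in> U \<and> fst p \<noteq> snd p \<and> (own \<circ> \<tau>) (fst p) = (own \<circ> \<tau>) (snd p)"
      unfolding inj_on_def by fastforce
    from someI_ex[OF this, folded pr_def]
    show "fst (pr (own \<circ> \<tau>)) \<in> U" "snd (pr (own \<circ> \<tau>)) \<in> U"
      "fst (pr (own \<circ> \<tau>)) \<noteq> snd (pr (own \<circ> \<tau>))"
      "own (\<tau> (fst (pr (own \<circ> \<tau>)))) = own (\<tau> (snd (pr (own \<circ> \<tau>))))"
      by simp_all
  qed
  have own: "own \<circ> \<iota> \<tau> = own \<circ> \<tau>" if "\<tau> \<in> ?N" for \<tau>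
    using pr[OF that] by (auto simp: \<iota>_def fun_eq_iff Transposition.transpose_def)
  have k: "k (\<iota> \<tau>) = - k \<tau>" if "\<tau> \<in> ?N" for \<tau>
    using pr[OF that] anti[of \<tau>] that by (auto simp: \<iota>_def)
  have \<iota>N: "\<iota> \<tau> \<in> ?N" if "\<tau> \<in> ?N" for \<tau>
  proof -
    have "\<iota> \<tau> permutes {..<n}"
      using pr[OF that] that U by (auto simp: \<iota>_def intro!: permutes_compose permutes_swap_id)
    then show ?thesis using own[OF that] that by simp
  qed
  have \<iota>\<iota>: "\<iota> (\<iota> \<tau>) = \<tau>" if "\<tau> \<in> ?N" for \<tau>
    using own[OF that] by (simp add: \<iota>_def comp_assoc)
  have "(\<Sum>\<tau>\<in>?N. k \<tau> * \<phi> (own \<circ> \<tau>)) = (\<Sum>\<tau>\<in>?N. - (k \<tau> * \<phi> (own \<circ> \<tau>)))"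
  proof (rule sum.reindex_bij_witness[where i = \<iota> and j = \<iota>])
    fix \<tau> assume \<tau>: "\<tau> \<in> ?N"
    show "\<iota> (\<iota> \<tau>) = \<tau>" "\<iota> (\<iota> \<tau>) = \<tau>" by (rule \<iota>\<iota>[OF \<tau>])+
    show "\<iota> \<tau> \<in> ?N" "\<iota> \<tau> \<in> ?N" by (rule \<iota>N[OF \<tau>])+
    show "- (k (\<iota> \<tau>) * \<phi> (own \<circ> \<iota> \<tau>)) = k \<tau> * \<phi> (own \<circ> \<tau>)"
      unfolding own[OF \<tau>] k[OF \<tau>] by simp
  qed
  then have zero: "(\<Sum>\<tau>\<in>?N. k \<tau> * \<phi> (own \<circ> \<tau>)) = 0" by (simp add: sum_negf)
  let ?I = "{\<tau>. \<tau> permutes {..<n} \<and> inj_on (own \<circ> \<tau>) U}"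
  have split: "{\<tau>. \<tau> permutes {..<n}} = ?N \<union> ?I" by blast
  have fin: "finite {\<tau>. \<tau> permutes {..<n} \<and> P \<tau>}" for P
    by (rule finite_subset[OF _ finite_permutations[of "{..<n}"]]) auto
  have "(\<Sum>\<tau> | \<tau> permutes {..<n}. k \<tau> * \<phi> (own \<circ> \<tau>)) =
    (\<Sum>\<tau>\<in>?N. k \<tau> * \<phi> (own \<circ> \<tau>)) + (\<Sum>\<tau>\<in>?I. k \<tau> * \<phi> (own \<circ> \<tau>))"
    unfolding split by (rule sum.union_disjoint[OF fin fin]) blast
  then show ?thesis unfolding zero by simp
qed

context composition
begin

text \<open>\<open>S\<close> is the set of tails \<open>j\<close> whose factor contributes its first term \<open>[\<dots> \<le> y]\<close>; the remaining
  tails contribute \<open>- [\<tau> j < j]\<close>, which does not depend on the positions.\<close>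

definition tail_coeff :: "nat set \<Rightarrow> (nat \<Rightarrow> nat) \<Rightarrow> real" where
  "tail_coeff S \<tau> = signof \<tau> * ((-1) ^ card (tails - S) * (\<Prod>j\<in>tails - S. of_bool (\<tau> j < j)))"

text \<open>Only the coordinates in \<open>heads \<union> S\<close> occur, as the remaining tails
  contribute no positions. An exchange of two columns is harmless exactly within this index
  set.\<close>

definition tail_event :: "real measure \<Rightarrow> (nat \<Rightarrow> real) set \<Rightarrow> nat set \<Rightarrow> (nat \<Rightarrow> real) set" where
  "tail_event \<nu> A S = {u \<in> space (PiM (heads \<union> S) (\<lambda>_. \<nu>)).
     (\<lambda>l\<in>{..<k}. u (start l)) \<in> A \<and> (\<forall>j\<in>S. u j \<le> u (head j))}"

text \<open>The remaining brackets \<open>[\<tau> j < j]\<close> belong to tails outside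
  \<open>S\<close>, which the exchange of \<open>a\<close> and \<open>b\<close> does not touch, so
  only the sign changes.\<close>

lemma tail_coeff_transpose:
  assumes "S \<subseteq> tails" "\<tau> permutes {..<n}" "a \<in> heads \<union> S" "b \<in> heads \<union> S" "a \<noteq> b"
  shows "tail_coeff S (\<tau> \<circ> Transposition.transpose a b) = - tail_coeff S \<tau>"
proof -
  have ab: "a \<notin> tails - S" "b \<notin> tails - S" using assms heads_tails(1) by auto
  have "(\<Prod>j\<in>tails - S. of_bool ((\<tau> \<circ> Transposition.transpose a b) j < j)) = (\<Prod>j\<in>tails - S. of_bool (\<tau> j < j) :: real)"
    by (rule prod.cong[OF refl]) (use ab in \<open>auto simp: Transposition.transpose_def\<close>)
  moreover have "sign (\<tau> \<circ> Transposition.transpose a b) = - sign \<tau>"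
    using assms by (subst sign_compose)
      (auto simp: sign_swap_id permutation_swap_id intro: permutes_imp_permutation[of "{..<n}"])
  ultimately show ?thesis by (simp add: tail_coeff_def)
qed

lemma coalescence_sum_expand:
  assumes w: "\<And>i. i < n \<Longrightarrow> w i \<in> space \<nu>"
  shows "coalescence_sum n c A w = (\<Sum>S\<in>Pow tails. \<Sum>\<tau> | \<tau> permutes {..<n}.
    tail_coeff S \<tau> * indicator (tail_event \<nu> A S) (\<lambda>j\<in>heads \<union> S. w (\<tau> j)))"
proof -
  have prod: "(\<Prod>j\<in>tails. of_bool (w (\<tau> j) \<le> w (\<tau> (head j))) - of_bool (\<tau> j < j)) =
    (\<Sum>S\<in>Pow tails. (-1) ^ card (tails - S) * (\<Prod>j\<in>tails - S. of_bool (\<tau> j < j)) *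
       (\<Prod>j\<in>S. of_bool (w (\<tau> j) \<le> w (\<tau> (head j)))) :: real)" for \<tau>
  proof -
    have "(\<Prod>j\<in>tails. of_bool (w (\<tau> j) \<le> w (\<tau> (head j))) - of_bool (\<tau> j < j)) =
      (\<Sum>S\<in>Pow tails. (-1) ^ card S * (\<Prod>j\<in>S. of_bool (\<tau> j < j)) *
       (\<Prod>j\<in>tails - S. of_bool (w (\<tau> j) \<le> w (\<tau> (head j)))) :: real)"
      by (rule prod_diff_conv_sum) simp
    \<comment> \<open>\<open>prod_diff_conv_sum\<close> indexes by the set of factors that
      contribute the subtracted term; passing to complements makes \<open>S\<close> the set of the
      other factors.\<close>
    also have "\<dots> = (\<Sum>S\<in>Pow tails. (-1) ^ card (tails - S) * (\<Prod>j\<in>tails - S. of_bool (\<tau> j < j)) *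
       (\<Prod>j\<in>S. of_bool (w (\<tau> j) \<le> w (\<tau> (head j)))) :: real)"
      by (rule sum.reindex_bij_witness[where i = "\<lambda>S. tails - S" and j = "\<lambda>S. tails - S"])
        (auto simp: double_diff)
    finally show ?thesis .
  qed
  have ind: "indicator A (\<lambda>l\<in>{..<k}. w (\<tau> (start l))) * (\<Prod>j\<in>S. of_bool (w (\<tau> j) \<le> w (\<tau> (head j)))) =
    (indicator (tail_event \<nu> A S) (\<lambda>j\<in>heads \<union> S. w (\<tau> j)) :: real)"
    if S: "S \<subseteq> tails" and \<tau>: "\<tau> permutes {..<n}" for S \<tau>
  proof -
    have "(\<lambda>l\<in>{..<k}. w (\<tau> (start l))) = (\<lambda>l\<in>{..<k}. (\<lambda>j\<in>heads \<union> S. w (\<tau> j)) (start l))"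
      by (auto simp: heads_def)
    moreover have "finite S" using S by (rule finite_subset) simp
    then have "(\<Prod>j\<in>S. of_bool (w (\<tau> j) \<le> w (\<tau> (head j)))) =
      (of_bool (\<forall>j\<in>S. w (\<tau> j) \<le> w (\<tau> (head j))) :: real)"
    proof (cases "\<forall>j\<in>S. w (\<tau> j) \<le> w (\<tau> (head j))")
      case False
      then show ?thesis using \<open>finite S\<close> by (auto intro!: prod_zero)
    qed simp
    moreover have "(\<forall>j\<in>S. w (\<tau> j) \<le> w (\<tau> (head j))) \<longleftrightarrow>
      (\<forall>j\<in>S. (\<lambda>j\<in>heads \<union> S. w (\<tau> j)) j \<le> (\<lambda>j\<in>heads \<union> S. w (\<tau> j)) (head j))"
      using S head_in_heads tails_subset by (intro ball_cong) auto
    moreover have "\<tau> j < n" if "j \<in> heads \<union> S" for j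
      using that S heads_subset tails_subset permutes_in_image[OF \<tau>, of j] by auto
    then have "(\<lambda>j\<in>heads \<union> S. w (\<tau> j)) \<in> space (PiM (heads \<union> S) (\<lambda>_. \<nu>))"
      using w by (auto simp: space_PiM)
    ultimately show ?thesis
      unfolding tail_event_def indicator_def of_bool_conj mem_Collect_eq by (simp only: simp_thms of_bool_eq mult_1)
  qed
  have "coalescence_sum n c A w = (\<Sum>\<tau> | \<tau> permutes {..<n}. \<Sum>S\<in>Pow tails.
    tail_coeff S \<tau> * indicator (tail_event \<nu> A S) (\<lambda>j\<in>heads \<union> S. w (\<tau> j)))"
    unfolding coalescence_sum_def
  proof (intro sum.cong[OF refl], unfold prod sum_distrib_left, intro sum.cong[OF refl])
    fix \<tau> S assume "\<tau> \<in> {\<tau>. \<tau> permutes {..<n}}" "S \<in> Pow tails"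
    then show "signof \<tau> * indicator A (\<lambda>l\<in>{..<k}. w (\<tau> (start l))) *
      ((- 1) ^ card (tails - S) * (\<Prod>j\<in>tails - S. of_bool (\<tau> j < j)) *
        (\<Prod>j\<in>S. of_bool (w (\<tau> j) \<le> w (\<tau> (head j))))) =
      tail_coeff S \<tau> * indicator (tail_event \<nu> A S) (\<lambda>j\<in>heads \<union> S. w (\<tau> j))"
      by (subst ind[symmetric]) (simp_all add: tail_coeff_def)
  qed
  also have "\<dots> = (\<Sum>S\<in>Pow tails. \<Sum>\<tau> | \<tau> permutes {..<n}.
    tail_coeff S \<tau> * indicator (tail_event \<nu> A S) (\<lambda>j\<in>heads \<union> S. w (\<tau> j)))"
    by (rule sum.swap)
  finally show ?thesis .
qed

lemma tail_event_sets:
  assumes \<nu>: "(\<lambda>u. u) \<in> borel_measurable \<nu>"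
    and A: "A \<in> sets (PiM {..<k} (\<lambda>_. \<nu>))" and S: "S \<subseteq> tails"
  shows "tail_event \<nu> A S \<in> sets (PiM (heads \<union> S) (\<lambda>_. \<nu>))"
proof -
  have fin: "finite S" using S by (rule finite_subset) simp
  have comp: "(\<lambda>u. u j) \<in> borel_measurable (PiM (heads \<union> S) (\<lambda>_. \<nu>))" if "j \<in> heads \<union> S" for j
    using measurable_compose[OF measurable_component_singleton[OF that] \<nu>] by simp
  have hd: "head j \<in> heads" if "j \<in> S" for j
    using that S tails_subset head_in_heads by blast
  have "(\<lambda>u. \<lambda>l\<in>{..<k}. u (start l)) \<in> PiM (heads \<union> S) (\<lambda>_. \<nu>) \<rightarrow>\<^sub>M PiM {..<k} (\<lambda>_. \<nu>)"
    by (intro measurable_restrict measurable_component_singleton) (auto simp: heads_def)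
  then have "(\<lambda>u. \<lambda>l\<in>{..<k}. u (start l)) -` A \<inter> space (PiM (heads \<union> S) (\<lambda>_. \<nu>))
    \<in> sets (PiM (heads \<union> S) (\<lambda>_. \<nu>))"
    using A by (rule measurable_sets)
  moreover have "{u \<in> space (PiM (heads \<union> S) (\<lambda>_. \<nu>)). u j \<le> u (head j)} \<in> sets (PiM (heads \<union> S) (\<lambda>_. \<nu>))"
    if "j \<in> S" for j
    using that hd by (intro borel_measurable_le comp) auto
  then have "{u \<in> space (PiM (heads \<union> S) (\<lambda>_. \<nu>)). \<forall>j\<in>S. u j \<le> u (head j)}
    \<in> sets (PiM (heads \<union> S) (\<lambda>_. \<nu>))"
    using fin by (rule sets.sets_Collect_finite_All)
  ultimately have "((\<lambda>u. \<lambda>l\<in>{..<k}. u (start l)) -` A \<inter> space (PiM (heads \<union> S) (\<lambda>_. \<nu>))) \<inter>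
    {u \<in> space (PiM (heads \<union> S) (\<lambda>_. \<nu>)). \<forall>j\<in>S. u j \<le> u (head j)} \<in> sets (PiM (heads \<union> S) (\<lambda>_. \<nu>))"
    by (rule sets.Int)
  also have "((\<lambda>u. \<lambda>l\<in>{..<k}. u (start l)) -` A \<inter> space (PiM (heads \<union> S) (\<lambda>_. \<nu>))) \<inter>
    {u \<in> space (PiM (heads \<union> S) (\<lambda>_. \<nu>)). \<forall>j\<in>S. u j \<le> u (head j)} = tail_event \<nu> A S"
    by (auto simp: tail_event_def)
  finally show ?thesis .
qed

end

section \<open>The signed sum over independent particles\<close>

lemma PiM_density:
  fixes \<nu> :: "'a measure" and p :: "'i \<Rightarrow> 'a \<Rightarrow> real"
  assumes \<nu>: "sigma_finite_measure \<nu>" and I: "finite I"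
    and meas: "\<And>i. i \<in> I \<Longrightarrow> p i \<in> borel_measurable \<nu>"
    and prob: "\<And>i. i \<in> I \<Longrightarrow> prob_space (density \<nu> (\<lambda>u. ennreal (p i u)))"
  shows "PiM I (\<lambda>i. density \<nu> (\<lambda>u. ennreal (p i u))) =
    density (PiM I (\<lambda>_. \<nu>)) (\<lambda>y. \<Prod>i\<in>I. ennreal (p i (y i)))"
proof -
  \<comment> \<open>The locale for products asks for sigma-finiteness at every index, so the family
    is completed by \<open>\<nu>\<close> outside \<open>I\<close>.\<close>
  define \<mu> where "\<mu> i = (if i \<in> I then density \<nu> (\<lambda>u. ennreal (p i u)) else \<nu>)" for i
  interpret D: product_sigma_finite \<mu>
    by (rule product_sigma_finite.intro) (simp add: \<mu>_def \<nu> prob prob_space_imp_sigma_finite)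
  interpret N: product_sigma_finite "\<lambda>_::'i. \<nu>"
    by (rule product_sigma_finite.intro) (rule \<nu>)
  have "density (PiM I (\<lambda>_. \<nu>)) (\<lambda>y. \<Prod>i\<in>I. ennreal (p i (y i))) = PiM I \<mu>"
  proof (rule D.PiM_eqI[OF I])
    show "sets (density (PiM I (\<lambda>_. \<nu>)) (\<lambda>y. \<Prod>i\<in>I. ennreal (p i (y i)))) = sets (PiM I \<mu>)"
      by (auto simp: \<mu>_def cong: sets_PiM_cong)
  next
    fix B assume "\<And>i. i \<in> I \<Longrightarrow> B i \<in> sets (\<mu> i)"
    then have B: "\<And>i. i \<in> I \<Longrightarrow> B i \<in> sets \<nu>" by (auto simp: \<mu>_def)
    have m: "(\<lambda>y. \<Prod>i\<in>I. ennreal (p i (y i))) \<in> borel_measurable (PiM I (\<lambda>_. \<nu>))"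
    proof (rule borel_measurable_prod_ennreal)
      fix i assume i: "i \<in> I"
      show "(\<lambda>y. ennreal (p i (y i))) \<in> borel_measurable (PiM I (\<lambda>_. \<nu>))"
        using measurable_compose[OF measurable_component_singleton[OF i] meas[OF i]] by simp
    qed
    have ind: "(\<Prod>i\<in>I. ennreal (p i (y i))) * indicator (Pi\<^sub>E I B) y =
      (\<Prod>i\<in>I. ennreal (p i (y i)) * indicator (B i) (y i))" if "y \<in> space (PiM I (\<lambda>_. \<nu>))" for y
    proof (cases "\<forall>i\<in>I. y i \<in> B i")
      case True
      then show ?thesis using that by (auto simp: space_PiM PiE_iff)
    next
      case False
      then obtain i where i: "i \<in> I" "y i \<notin> B i" by blast
      then have "(\<Prod>i\<in>I. ennreal (p i (y i)) * indicator (B i) (y i)) = 0"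
        by (intro prod_zero[OF I] bexI[OF _ i(1)]) simp
      with False show ?thesis by (auto simp: PiE_iff)
    qed
    have "emeasure (density (PiM I (\<lambda>_. \<nu>)) (\<lambda>y. \<Prod>i\<in>I. ennreal (p i (y i)))) (Pi\<^sub>E I B) =
      (\<integral>\<^sup>+y. (\<Prod>i\<in>I. ennreal (p i (y i)) * indicator (B i) (y i)) \<partial>PiM I (\<lambda>_. \<nu>))"
      using B I m by (subst emeasure_density) (auto intro!: nn_integral_cong ind sets_PiM_I_finite)
    also have "\<dots> = (\<Prod>i\<in>I. \<integral>\<^sup>+u. ennreal (p i u) * indicator (B i) u \<partial>\<nu>)"
      using B meas I by (intro N.product_nn_integral_prod) auto
    also have "\<dots> = (\<Prod>i\<in>I. emeasure (\<mu> i) (B i))"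
      using B meas by (intro prod.cong) (auto simp: \<mu>_def emeasure_density)
    finally show "emeasure (density (PiM I (\<lambda>_. \<nu>)) (\<lambda>y. \<Prod>i\<in>I. ennreal (p i (y i)))) (Pi\<^sub>E I B) =
      (\<Prod>i\<in>I. emeasure (\<mu> i) (B i))" .
  qed
  also have "PiM I \<mu> = PiM I (\<lambda>i. density \<nu> (\<lambda>u. ennreal (p i u)))"
    by (rule PiM_cong) (auto simp: \<mu>_def)
  finally show ?thesis by simp
qed

context composition
begin

text \<open>By Fubini the tail coordinates are integrated first: with the heads held fixed they are
  independent, and each bracket integrates to its distribution function minus \<open>b j\<close>.
  The heads are then relabelled by their block numbers and their densities are inserted. The
  constant \<open>b j\<close> stands for \<open>[\<tau> j < j]\<close> with \<open>\<tau>\<close>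
  fixed.\<close>

lemma integral_heads_tails:
  fixes \<mu> :: "nat \<Rightarrow> real measure" and p :: "nat \<Rightarrow> real \<Rightarrow> real" and b :: "nat \<Rightarrow> real"
  assumes \<nu>: "sigma_finite_measure \<nu>" "(\<lambda>u. u) \<in> borel_measurable \<nu>"
    and A: "A \<in> sets (PiM {..<k} (\<lambda>_. \<nu>))"
    and prob: "\<And>j. prob_space (\<mu> j)" and sets_\<mu> [measurable_cong]: "\<And>j. sets (\<mu> j) = sets \<nu>"
    and p: "\<And>j. j < n \<Longrightarrow> p j \<in> borel_measurable \<nu>" "\<And>j u. j < n \<Longrightarrow> u \<in> space \<nu> \<Longrightarrow> 0 \<le> p j u"
    and dens: "\<And>j. j < n \<Longrightarrow> \<mu> j = density \<nu> (\<lambda>u. ennreal (p j u))"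
  defines "h \<equiv> \<lambda>v. indicator A (\<lambda>l\<in>{..<k}. v (start l)) * (\<Prod>j\<in>tails. of_bool (v j \<le> v (head j)) - b j)"
    and "g \<equiv> \<lambda>y. indicator A y * ((\<Prod>l<k. p (start l) (y l)) *
          (\<Prod>j\<in>tails. measure (\<mu> j) {u \<in> space \<nu>. u \<le> y (block_of c j)} - b j))"
  shows "integral\<^sup>L (PiM {..<n} \<mu>) h = integral\<^sup>L (PiM {..<k} (\<lambda>_. \<nu>)) g"
    and "integrable (PiM {..<k} (\<lambda>_. \<nu>)) g"
    and "integrable (PiM {..<n} \<mu>) h"
proof -
  interpret \<mu>: product_prob_space \<mu> "{..<n}"
    by (rule product_prob_spaceI) (rule prob)
  have id_\<mu>: "(\<lambda>u. u) \<in> borel_measurable (\<mu> j)" for j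
    using \<nu>(2) by (simp cong: measurable_cong_sets add: sets_\<mu>)
  have sp: "space (\<mu> j) = space \<nu>" for j
    using sets_\<mu> by (rule sets_eq_imp_space_eq)
  have comp: "(\<lambda>v. v j) \<in> borel_measurable (PiM I \<mu>)" if "j \<in> I" for j I
    using measurable_compose[OF measurable_component_singleton[OF that] id_\<mu>] by simp
  have restr: "(\<lambda>v. \<lambda>l\<in>{..<k}. v (start l)) \<in> PiM I \<mu> \<rightarrow>\<^sub>M PiM {..<k} (\<lambda>l. \<mu> (start l))"
    if "heads \<subseteq> I" for I
    using that by (intro measurable_restrict measurable_component_singleton) (auto simp: heads_def)
  have A': "A \<in> sets (PiM {..<k} (\<lambda>l. \<mu> (start l)))"
    using A by (simp add: sets_\<mu> cong: sets_PiM_cong)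
  have indA: "(\<lambda>v. indicator A (\<lambda>l\<in>{..<k}. v (start l)) :: real) \<in> borel_measurable (PiM I \<mu>)"
    if "heads \<subseteq> I" for I
    by (rule measurable_compose[OF restr[OF that] borel_measurable_indicator[OF A']])
  have tail_meas: "(\<lambda>v. of_bool (v j \<le> v (head j)) - b j :: real) \<in> borel_measurable (PiM {..<n} \<mu>)"
    if "j \<in> tails" for j
  proof -
    have j: "j \<in> {..<n}" "head j \<in> {..<n}"
      using that tails_subset heads_subset head_in_heads by blast+
    have "{v \<in> space (PiM {..<n} \<mu>). v j \<le> v (head j)} \<in> sets (PiM {..<n} \<mu>)"
      by (intro borel_measurable_le comp j)
    then have "Measurable.pred (PiM {..<n} \<mu>) (\<lambda>v. v j \<le> v (head j))"
      by (simp add: pred_def)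
    then show ?thesis by measurable
  qed
  have h_meas: "h \<in> borel_measurable (PiM {..<n} \<mu>)"
    unfolding h_def using heads_subset
    by (intro borel_measurable_times indA borel_measurable_prod tail_meas)
  have h_bound: "\<bar>h v\<bar> \<le> (\<Prod>j\<in>tails. 1 + \<bar>b j\<bar>)" for v
  proof -
    have "\<bar>\<Prod>j\<in>tails. of_bool (v j \<le> v (head j)) - b j\<bar> \<le> (\<Prod>j\<in>tails. 1 + \<bar>b j\<bar>)"
      unfolding abs_prod by (intro prod_mono) auto
    then show ?thesis
      unfolding h_def by (auto simp: indicator_def intro!: prod_nonneg)
  qed
  show int_h: "integrable (PiM {..<n} \<mu>) h"
    by (rule \<mu>.P.integrable_const_bound[where B = "\<Prod>j\<in>tails. 1 + \<bar>b j\<bar>"]) (use h_bound h_meas in auto)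
  define F where "F j y = measure (\<mu> j) {u \<in> space \<nu>. u \<le> y}" for j y
  have le_sets: "{u \<in> space \<nu>. u \<le> y} \<in> sets \<nu>" for y
    using borel_measurable_le[OF \<nu>(2) borel_measurable_const[of y]] by simp
  have F_meas: "F j \<in> borel_measurable borel" for j
  proof (rule borel_measurable_mono, rule monoI)
    fix y y' :: real assume "y \<le> y'"
    then show "F j y \<le> F j y'"
      unfolding F_def by (intro \<mu>.M.finite_measure_mono) (auto simp: sets_\<mu> le_sets)
  qed
  define g' where "g' y = indicator A y * (\<Prod>j\<in>tails. F j (y (block_of c j)) - b j)" for y
  have block: "block_of c j \<in> {..<k}" if "j \<in> tails" for j
    using that tails_subset block_of(1) by auto
  have g'_meas0: "g' \<in> borel_measurable (PiM {..<k} (\<lambda>_. \<nu>))"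
  proof -
    have "(\<lambda>y. F j (y (block_of c j)) - b j) \<in> borel_measurable (PiM {..<k} (\<lambda>_. \<nu>))" if "j \<in> tails" for j
      using measurable_compose[OF measurable_compose[OF measurable_component_singleton[OF block[OF that]] \<nu>(2)] F_meas]
      by simp
    then show ?thesis
      unfolding g'_def using A by (intro borel_measurable_times borel_measurable_indicator borel_measurable_prod)
  qed
  then have g'_meas: "g' \<in> borel_measurable (PiM {..<k} (\<lambda>l. \<mu> (start l)))"
    by (simp add: sets_\<mu> cong: measurable_cong_sets sets_PiM_cong)
  have inner: "(\<integral>v. h (merge heads tails (u, v)) \<partial>PiM tails \<mu>) = g' (\<lambda>l\<in>{..<k}. u (start l))" for u
  proof -
    have "h (merge heads tails (u, v)) =
      indicator A (\<lambda>l\<in>{..<k}. u (start l)) * (\<Prod>j\<in>tails. of_bool (v j \<le> u (head j)) - b j)" for v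
    proof -
      have "(\<lambda>l\<in>{..<k}. merge heads tails (u, v) (start l)) = (\<lambda>l\<in>{..<k}. u (start l))"
        by (auto simp: heads_def merge_def)
      moreover have "merge heads tails (u, v) j = v j" "merge heads tails (u, v) (head j) = u (head j)"
        if "j \<in> tails" for j
        using that heads_tails(1) head_in_heads[of j] tails_subset by (auto simp: merge_def)
      ultimately show ?thesis by (simp add: h_def cong: prod.cong)
    qed
    then have "(\<integral>v. h (merge heads tails (u, v)) \<partial>PiM tails \<mu>) =
      indicator A (\<lambda>l\<in>{..<k}. u (start l)) *
        (\<integral>v. (\<Prod>j\<in>tails. of_bool (v j \<le> u (head j)) - b j) \<partial>PiM tails \<mu>)" by simp
    also have "(\<integral>v. (\<Prod>j\<in>tails. of_bool (v j \<le> u (head j)) - b j) \<partial>PiM tails \<mu>) =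
      (\<Prod>j\<in>tails. \<integral>r. of_bool (r \<le> u (head j)) - b j \<partial>\<mu> j)"
    proof (rule \<mu>.product_integral_prod)
      fix j
      have "Measurable.pred (\<mu> j) (\<lambda>r. r \<le> u (head j))"
        using le_sets by (simp add: pred_def sets_\<mu> sp)
      then show "integrable (\<mu> j) (\<lambda>r. of_bool (r \<le> u (head j)) - b j)"
        by (intro \<mu>.M.integrable_const_bound[where B = "1 + \<bar>b j\<bar>"]) auto
    qed simp
    also have "(\<Prod>j\<in>tails. \<integral>r. of_bool (r \<le> u (head j)) - b j \<partial>\<mu> j) =
      (\<Prod>j\<in>tails. F j (u (head j)) - b j)"
    proof (rule prod.cong[OF refl])
      fix j
      let ?B = "{r \<in> space \<nu>. r \<le> u (head j)}"
      have B: "?B \<in> sets (\<mu> j)" using le_sets by (simp add: sets_\<mu>)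
      have "(\<integral>r. of_bool (r \<le> u (head j)) - b j \<partial>\<mu> j) = (\<integral>r. indicator ?B r - b j \<partial>\<mu> j)"
        by (intro Bochner_Integration.integral_cong) (auto simp: sp indicator_def)
      also have "\<dots> = F j (u (head j)) - b j"
        using B by (subst Bochner_Integration.integral_diff)
          (auto simp: F_def \<mu>.M.prob_space \<mu>.M.emeasure_eq_measure intro!: integrable_real_indicator)
      finally show "(\<integral>r. of_bool (r \<le> u (head j)) - b j \<partial>\<mu> j) = F j (u (head j)) - b j" .
    qed
    also have "indicator A (\<lambda>l\<in>{..<k}. u (start l)) * (\<Prod>j\<in>tails. F j (u (head j)) - b j) =
      g' (\<lambda>l\<in>{..<k}. u (start l))"
      using block by (auto simp: g'_def intro!: prod.cong arg_cong2[where f = "(*)"])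
    finally show ?thesis .
  qed
  define d where "d y = (\<Prod>l<k. p (start l) (y l))" for y
  have d_nonneg: "0 \<le> d y" if "y \<in> space (PiM {..<k} (\<lambda>_. \<nu>))" for y
    unfolding d_def using that by (intro prod_nonneg) (auto simp: space_PiM PiE_iff p(2) start_less_n)
  have p_meas: "(\<lambda>y. p (start l) (y l)) \<in> borel_measurable (PiM {..<k} (\<lambda>_. \<nu>))" if "l \<in> {..<k}" for l
    using that by (intro measurable_compose[OF measurable_component_singleton[OF that], where g = "p (start l)"])
      (simp add: p(1) start_less_n)
  have d_meas: "d \<in> borel_measurable (PiM {..<k} (\<lambda>_. \<nu>))"
    unfolding d_def by (intro borel_measurable_prod p_meas)
  have "PiM {..<k} (\<lambda>l. \<mu> (start l)) = PiM {..<k} (\<lambda>l. density \<nu> (\<lambda>u. ennreal (p (start l) u)))"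
    by (intro PiM_cong) (auto simp: dens start_less_n)
  also have "\<dots> = density (PiM {..<k} (\<lambda>_. \<nu>)) (\<lambda>y. \<Prod>l<k. ennreal (p (start l) (y l)))"
    by (intro PiM_density \<nu>(1)) (auto simp: p start_less_n prob simp flip: dens)
  also have "\<dots> = density (PiM {..<k} (\<lambda>_. \<nu>)) (\<lambda>y. ennreal (d y))"
    unfolding d_def
  proof (rule density_cong)
    show "(\<lambda>y. \<Prod>l<k. ennreal (p (start l) (y l))) \<in> borel_measurable (PiM {..<k} (\<lambda>_. \<nu>))"
      by (intro borel_measurable_prod_ennreal measurable_compose[OF p_meas measurable_ennreal])
    show "AE y in PiM {..<k} (\<lambda>_. \<nu>). (\<Prod>l<k. ennreal (p (start l) (y l))) = ennreal (\<Prod>l<k. p (start l) (y l))"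
      by (rule AE_I2, rule prod_ennreal) (auto simp: space_PiM PiE_iff p(2) start_less_n)
  qed (use d_meas in \<open>simp add: d_def[abs_def]\<close>)
  finally have D: "PiM {..<k} (\<lambda>l. \<mu> (start l)) = density (PiM {..<k} (\<lambda>_. \<nu>)) (\<lambda>y. ennreal (d y))" .
  have g: "g = (\<lambda>y. d y * g' y)"
    by (simp add: g_def g'_def d_def F_def fun_eq_iff)
  \<comment> \<open>The injection \<open>start\<close> identifies block numbers with heads, so
    relabelling keeps the product law.\<close>
  have reindex: "distr (PiM heads \<mu>) (PiM {..<k} (\<lambda>l. \<mu> (start l))) (\<lambda>u. \<lambda>l\<in>{..<k}. u (start l)) =
    PiM {..<k} (\<lambda>l. \<mu> (start l))"
    by (rule distr_PiM_reindex) (auto simp: prob inj_start heads_def)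
  have "integral\<^sup>L (PiM {..<n} \<mu>) h = (\<integral>u. (\<integral>v. h (merge heads tails (u, v)) \<partial>PiM tails \<mu>) \<partial>PiM heads \<mu>)"
    using \<mu>.product_integral_fold[of heads tails h] int_h heads_tails by simp
  also have "\<dots> = (\<integral>u. g' (\<lambda>l\<in>{..<k}. u (start l)) \<partial>PiM heads \<mu>)"
    by (simp add: inner)
  also have "\<dots> = integral\<^sup>L (PiM {..<k} (\<lambda>l. \<mu> (start l))) g'"
    by (subst reindex[symmetric], subst integral_distr) (auto simp: restr g'_meas)
  also have "\<dots> = integral\<^sup>L (PiM {..<k} (\<lambda>_. \<nu>)) g"
    unfolding D g using d_nonneg d_meas g'_meas0 by (intro integral_real_density) auto
  finally show "integral\<^sup>L (PiM {..<n} \<mu>) h = integral\<^sup>L (PiM {..<k} (\<lambda>_. \<nu>)) g" .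
  \<comment> \<open>The reference measure \<open>\<nu>\<close> is infinite in the application.
    Integrability of \<open>g\<close> against its power is read off from boundedness of
    \<open>g'\<close> under the probability measure with density \<open>d\<close>.\<close>
  have "integrable (PiM {..<k} (\<lambda>l. \<mu> (start l))) g'"
  proof -
    interpret P: prob_space "PiM {..<k} (\<lambda>l. \<mu> (start l))" by (intro prob_space_PiM prob)
    have "\<bar>g' y\<bar> \<le> (\<Prod>j\<in>tails. 1 + \<bar>b j\<bar>)" for y
    proof -
      have "\<bar>F j y - b j\<bar> \<le> 1 + \<bar>b j\<bar>" for j y
        using prob_space.prob_le_1[OF prob, of j] measure_nonneg[of "\<mu> j"] unfolding F_def
        by (smt (verit))
      then have "\<bar>\<Prod>j\<in>tails. F j (y (block_of c j)) - b j\<bar> \<le> (\<Prod>j\<in>tails. 1 + \<bar>b j\<bar>)"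
        unfolding abs_prod by (intro prod_mono) auto
      then show ?thesis
        unfolding g'_def by (auto simp: indicator_def intro!: prod_nonneg)
    qed
    then show ?thesis
      by (intro P.integrable_const_bound[where B = "\<Prod>j\<in>tails. 1 + \<bar>b j\<bar>"]) (use g'_meas in auto)
  qed
  then show "integrable (PiM {..<k} (\<lambda>_. \<nu>)) g"
    unfolding D g using d_nonneg d_meas g'_meas0 by (subst (asm) integrable_real_density) auto
qed

end

section \<open>The coalescing trajectories\<close>

lemma meeting_time_commute: "meeting_time T X I J \<omega> = meeting_time T X J I \<omega>"
proof -
  have "X I t \<omega> = X J t \<omega> \<longleftrightarrow> X J t \<omega> = X I t \<omega>" for t by auto
  then show ?thesis unfolding meeting_time_def by (simp only:)
qed

lemma meeting_time_le: "t \<in> {0..T} \<Longrightarrow> X I t \<omega> = X J t \<omega> \<Longrightarrow> meeting_time T X I J \<omega> \<le> ennreal t"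
  unfolding meeting_time_def by (intro Inf_lower) blast

lemma meeting_time_le_T: "meeting_time T X I J \<omega> \<noteq> \<infinity> \<Longrightarrow> meeting_time T X I J \<omega> \<le> ennreal T"
proof -
  assume "meeting_time T X I J \<omega> \<noteq> \<infinity>"
  then have "{ennreal t | t. t \<in> {0..T} \<and> X I t \<omega> = X J t \<omega>} \<noteq> {}"
    unfolding meeting_time_def by (metis Inf_empty infinity_ennreal_def)
  then obtain t where "t \<in> {0..T}" "X I t \<omega> = X J t \<omega>" by auto
  then show ?thesis
    using meeting_time_le[of t T X I \<omega> J] by (auto intro: order_trans ennreal_leI)
qed

text \<open>Taken over unordered pairs and without reference to \<open>pr\<close>, it is a finite
  infimum of meeting times and thereby a stopping time. Without a pair of active particles it is
  \<open>\<infinity>\<close>.\<close>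

definition collision_time :: "real \<Rightarrow> nat \<Rightarrow> (nat \<Rightarrow> real \<Rightarrow> 'w \<Rightarrow> real) \<Rightarrow> (nat \<Rightarrow> nat) \<Rightarrow> 'w \<Rightarrow> ennreal" where
  "collision_time T n X own \<omega> =
     (INF (I, J)\<in>{(I, J). I \<in> own ` {..<n} \<and> J \<in> own ` {..<n} \<and> I < J}. meeting_time T X I J \<omega>)"

lemma finite_active_pairs: "finite {(I, J). I \<in> own ` {..<n} \<and> J \<in> own ` {..<n::nat} \<and> I < (J::nat)}"
  by (rule finite_subset[of _ "own ` {..<n} \<times> own ` {..<n}"]) auto

lemma collision_time_le:
  assumes "I \<in> own ` {..<n}" "J \<in> own ` {..<n}" "I \<noteq> J"
  shows "collision_time T n X own \<omega> \<le> meeting_time T X I J \<omega>"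
proof -
  have "collision_time T n X own \<omega> \<le> meeting_time T X I J \<omega>"
    if "I \<in> own ` {..<n}" "J \<in> own ` {..<n}" "I < J" for I J
    unfolding collision_time_def using that by (intro INF_lower2[of "(I, J)"]) auto
  from this[of I J] this[of J I] show ?thesis
    using assms meeting_time_commute[of T X I J \<omega>] by (metis nat_neq_iff)
qed

lemma collision_time_attained:
  assumes "collision_time T n X own \<omega> \<noteq> \<infinity>"
  obtains I J where "I \<in> own ` {..<n}" "J \<in> own ` {..<n}" "I < J"
    "meeting_time T X I J \<omega> = collision_time T n X own \<omega>"
proof -
  let ?S = "(\<lambda>(I, J). meeting_time T X I J \<omega>) ` {(I, J). I \<in> own ` {..<n} \<and> J \<in> own ` {..<n} \<and> I < J}"
  have "?S \<noteq> {}"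
  proof
    assume "?S = {}"
    then have "collision_time T n X own \<omega> = Inf {}" unfolding collision_time_def by (simp only:)
    with assms show False by simp
  qed
  moreover have fin: "finite ?S" by (intro finite_imageI finite_active_pairs)
  ultimately have "Inf ?S \<in> ?S"
    using Min_Inf[of ?S] Min_in[of ?S] by simp
  then obtain p where p: "p \<in> {(I, J). I \<in> own ` {..<n} \<and> J \<in> own ` {..<n} \<and> I < J}"
    "collision_time T n X own \<omega> = (case p of (I, J) \<Rightarrow> meeting_time T X I J \<omega>)"
    unfolding collision_time_def by (rule imageE)
  show ?thesis
    by (rule that[of "fst p" "snd p"]) (use p in \<open>simp_all split: prod.splits\<close>)
qed

lemma collision_time_le_T: "collision_time T n X own \<omega> \<noteq> \<infinity> \<Longrightarrow> collision_time T n X own \<omega> \<le> ennreal T"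
  by (metis collision_time_attained meeting_time_le_T)

text \<open>Fewer active particles leave fewer pairs in the infimum. Since collisions only shrink
  the active set, collision times increase along the process, and the sigma-algebras of their pasts
  increase with them.\<close>

lemma collision_time_mono:
  "own' ` {..<n} \<subseteq> own ` {..<n} \<Longrightarrow> collision_time T n X own \<omega> \<le> collision_time T n X own' \<omega>"
  unfolding collision_time_def by (intro INF_superset_mono) auto

text \<open>Two active particles collide next exactly when their meeting time attains the infimum;
  this reduces the set of collisions to comparisons of stopping times.\<close>

lemma next_collisions_iff:
  "(I, J) \<in> next_collisions T n pr X \<omega> own \<longleftrightarrow>
     I \<in> own ` {..<n} \<and> J \<in> own ` {..<n} \<and> pr I < pr J \<and> collision_time T n X own \<omega> \<noteq> \<infinity> \<and>
     meeting_time T X I J \<omega> = collision_time T n X own \<omega>"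
proof
  assume IJ: "(I, J) \<in> next_collisions T n pr X \<omega> own"
  then have "meeting_time T X I J \<omega> \<le> collision_time T n X own \<omega>"
    unfolding collision_time_def by (intro INF_greatest) (auto simp: next_collisions_def)
  moreover have "collision_time T n X own \<omega> \<le> meeting_time T X I J \<omega>"
    using IJ by (intro collision_time_le) (auto simp: next_collisions_def)
  ultimately show "I \<in> own ` {..<n} \<and> J \<in> own ` {..<n} \<and> pr I < pr J \<and> collision_time T n X own \<omega> \<noteq> \<infinity> \<and>
     meeting_time T X I J \<omega> = collision_time T n X own \<omega>"
    using IJ by (auto simp: next_collisions_def)
next
  assume "I \<in> own ` {..<n} \<and> J \<in> own ` {..<n} \<and> pr I < pr J \<and> collision_time T n X own \<omega> \<noteq> \<infinity> \<and>
     meeting_time T X I J \<omega> = collision_time T n X own \<omega>"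
  then show "(I, J) \<in> next_collisions T n pr X \<omega> own"
    unfolding next_collisions_def using collision_time_le[of _ own n _ T X \<omega>] by auto
qed

text \<open>Fixing the values from \<open>n\<close> on makes this set of total functions finite, so
  the random owner map can be treated by a finite case distinction.\<close>

definition owners :: "nat \<Rightarrow> (nat \<Rightarrow> nat) set" where
  "owners n = {own. (\<forall>j<n. own j < n) \<and> (\<forall>j\<ge>n. own j = j)}"

lemma owners_image: "own \<in> owners n \<Longrightarrow> own ` {..<n} \<subseteq> {..<n}"
  by (auto simp: owners_def)

lemma finite_owners: "finite (owners n)"
proof (rule inj_on_finite)
  show "inj_on (\<lambda>own. restrict own {..<n}) (owners n)"
  proof (rule inj_onI, rule ext)
    fix f g j assume *: "f \<in> owners n" "g \<in> owners n" "restrict f {..<n} = restrict g {..<n}"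
    show "f j = g j"
      using *(1,2) fun_cong[OF *(3), of j] by (cases "j < n") (auto simp: owners_def)
  qed
  show "(\<lambda>own. restrict own {..<n}) ` owners n \<subseteq> {..<n} \<rightarrow>\<^sub>E {..<n}"
    by (intro image_subsetI restrict_PiE_iff[THEN iffD2]) (simp add: owners_def)
qed (simp add: finite_PiE)

text \<open>Injectivity of \<open>pr\<close> orders any two particles that meet, so an attained
  collision time always provides a winner and a loser.\<close>

lemma next_collisions_empty_iff:
  assumes "own \<in> owners n" "inj_on pr {..<n}"
  shows "next_collisions T n pr X \<omega> own = {} \<longleftrightarrow> collision_time T n X own \<omega> = \<infinity>"
proof
  assume "collision_time T n X own \<omega> = \<infinity>"
  then show "next_collisions T n pr X \<omega> own = {}"
    using next_collisions_iff[of _ _ T n pr X \<omega> own] by auto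
next
  assume empty: "next_collisions T n pr X \<omega> own = {}"
  show "collision_time T n X own \<omega> = \<infinity>"
  proof (rule ccontr)
    assume fin: "collision_time T n X own \<omega> \<noteq> \<infinity>"
    then obtain I J where IJ: "I \<in> own ` {..<n}" "J \<in> own ` {..<n}" "I < J"
      "meeting_time T X I J \<omega> = collision_time T n X own \<omega>"
      by (rule collision_time_attained)
    have "pr I \<noteq> pr J"
      using IJ(1-3) owners_image[OF assms(1)] inj_onD[OF assms(2), of I J] by blast
    then have "(I, J) \<in> next_collisions T n pr X \<omega> own \<or> (J, I) \<in> next_collisions T n pr X \<omega> own"
      using IJ fin meeting_time_commute[of T X I J \<omega>] by (auto simp: next_collisions_iff)
    with empty show False by blast
  qed
qed

lemma finite_next_collisions: "finite (next_collisions T n pr X \<omega> own)"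
  by (rule finite_subset[of _ "own ` {..<n} \<times> own ` {..<n}"]) (auto simp: next_collisions_def)

lemma collide_no_collision: "next_collisions T n pr X \<omega> own = {} \<Longrightarrow> collide T n pr X \<omega> own = own"
  by (simp add: collide_def Let_def)

lemma collide_collision:
  assumes "next_collisions T n pr X \<omega> own \<noteq> {}"
  obtains I J where "(I, J) \<in> next_collisions T n pr X \<omega> own"
    "collide T n pr X \<omega> own = (\<lambda>j. if own j = J then I else own j)"
proof -
  let ?C = "next_collisions T n pr X \<omega> own"
  let ?I = "arg_min_on pr (fst ` ?C)"
  let ?J = "arg_min_on pr {J. (?I, J) \<in> ?C}"
  have "?I \<in> fst ` ?C"
    using assms by (intro arg_min_if_finite finite_imageI finite_next_collisions) auto
  then have "{J. (?I, J) \<in> ?C} \<noteq> {}" by force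
  moreover have "finite {J. (?I, J) \<in> ?C}"
    by (rule finite_subset[OF _ finite_imageI[OF finite_next_collisions, of snd]]) force
  ultimately have "?J \<in> {J. (?I, J) \<in> ?C}" by (intro arg_min_if_finite)
  then show ?thesis
    using assms that by (simp add: collide_def Let_def)
qed

lemma collide_image_subset: "collide T n pr X \<omega> own ` {..<n} \<subseteq> own ` {..<n}"
proof (cases "next_collisions T n pr X \<omega> own = {}")
  case False
  then show ?thesis by (rule collide_collision) (auto simp: next_collisions_iff)
qed (simp add: collide_no_collision)

lemma collide_owners:
  assumes "own \<in> owners n"
  shows "collide T n pr X \<omega> own \<in> owners n"
proof (cases "next_collisions T n pr X \<omega> own = {}")
  case False
  then obtain I J where IJ: "(I, J) \<in> next_collisions T n pr X \<omega> own"
    "collide T n pr X \<omega> own = (\<lambda>j. if own j = J then I else own j)" by (rule collide_collision)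
  then have "I < n" "J < n" using owners_image[OF assms] by (auto simp: next_collisions_iff)
  with IJ assms show ?thesis by (auto simp: owners_def)
qed (use assms in \<open>simp add: collide_no_collision\<close>)

lemma id_owners: "id \<in> owners n"
  by (simp add: owners_def)

lemma funpow_collide_owners:
  "own \<in> owners n \<Longrightarrow> (collide T n pr X \<omega> ^^ m) own \<in> owners n"
  by (induction m) (auto simp: collide_owners)

lemma card_collide_less:
  assumes "next_collisions T n pr X \<omega> own \<noteq> {}"
  shows "card (collide T n pr X \<omega> own ` {..<n}) < card (own ` {..<n})"
  using assms
proof (rule collide_collision)
  fix I J assume IJ: "(I, J) \<in> next_collisions T n pr X \<omega> own"
    "collide T n pr X \<omega> own = (\<lambda>j. if own j = J then I else own j)"
  then have "I \<noteq> J" "J \<in> own ` {..<n}" by (auto simp: next_collisions_iff)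
  then show ?thesis
    using collide_image_subset[of T n pr X \<omega> own] unfolding IJ(2)
    by (intro psubset_card_mono) auto
qed

text \<open>While collisions remain, each step loses an active particle, so at most
  \<open>n - m\<close> are active after \<open>m\<close> steps. At \<open>m = n\<close> either the
  process has stopped or no particle would be active.\<close>

lemma next_collisions_final_own: "next_collisions T n pr X \<omega> (final_own T n pr X \<omega>) = {}"
proof -
  define own where "own m = (collide T n pr X \<omega> ^^ m) id" for m
  have own_Suc: "own (Suc m) = collide T n pr X \<omega> (own m)" for m
    by (simp add: own_def)
  have "next_collisions T n pr X \<omega> (own m) = {} \<or> card (own m ` {..<n}) + m \<le> n" for m
  proof (induction m)
    case (Suc m)
    show ?case
    proof (cases "next_collisions T n pr X \<omega> (own m) = {}")
      case False
      with Suc card_collide_less[OF False] show ?thesis by (simp add: own_Suc)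
    qed (simp add: own_Suc collide_no_collision)
  qed (simp add: own_def)
  from this[of n] have "next_collisions T n pr X \<omega> (own n) = {} \<or> own n ` {..<n} = {}"
    by auto
  moreover have "next_collisions T n pr X \<omega> (own n) = {}" if "own n ` {..<n} = {}"
    using that by (simp add: next_collisions_def)
  ultimately show ?thesis unfolding final_own_def own_def by blast
qed

text \<open>The pathwise content of \<open>KM3\<close> and \<open>KM4\<close>, valid for almost
  every \<open>\<omega>\<close> (\<open>AE_ordered\<close>). The order of the owners is studied for
  one such \<open>\<omega>\<close>, without probability.\<close>

locale ordered_trajectories =
  fixes T :: real and n :: nat and X :: "nat \<Rightarrow> real \<Rightarrow> 'w \<Rightarrow> real" and \<omega> :: 'w
  assumes T_nonneg: "0 \<le> T"
    and order_kept: "\<And>I J t. I < J \<Longrightarrow> J < n \<Longrightarrow> t \<in> {0..T} \<Longrightarrow>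
      (\<And>s. s \<in> {0..t} \<Longrightarrow> X I s \<omega> \<noteq> X J s \<omega>) \<Longrightarrow> X I t \<omega> < X J t \<omega>"
    and meet: "\<And>I J. I < J \<Longrightarrow> J < n \<Longrightarrow> meeting_time T X I J \<omega> \<noteq> \<infinity> \<Longrightarrow>
      X I (enn2real (meeting_time T X I J \<omega>)) \<omega> = X J (enn2real (meeting_time T X I J \<omega>)) \<omega>"
begin

lemma meet':
  assumes "I < n" "J < n" "meeting_time T X I J \<omega> = ennreal s" "0 \<le> s"
  shows "X I s \<omega> = X J s \<omega>"
  using assms meet[of I J] meet[of J I] meeting_time_commute[of T X I J \<omega>]
  by (cases I J rule: linorder_cases) auto

text \<open>No two active particles meet before the collision time \<open>s\<close>. If
  \<open>b\<close> differed from \<open>a\<close> and \<open>a'\<close> at time \<open>s\<close>, it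
  would not have met them up to \<open>s\<close>, and order preservation would give
  \<open>X a s \<omega> < X b s \<omega> < X a' s \<omega>\<close>, against the equality of the
  outer two.\<close>

lemma between:
  assumes own: "own \<in> owners n" "{a, b, a'} \<subseteq> own ` {..<n}" "a < b" "b < a'"
    and s: "collision_time T n X own \<omega> = ennreal s" "s \<in> {0..T}"
    and eq: "X a s \<omega> = X a' s \<omega>"
  shows "X b s \<omega> = X a s \<omega>"
proof (rule ccontr)
  assume ne: "X b s \<omega> \<noteq> X a s \<omega>"
  have lt: "a < n" "b < n" "a' < n" using own owners_image[of own n] by auto
  have early: "s' = s" if "X I s' \<omega> = X J s' \<omega>" "s' \<in> {0..s}" "{I, J} \<subseteq> own ` {..<n}" "I \<noteq> J" for I J s'
  proof -
    have "meeting_time T X I J \<omega> \<le> ennreal s'" using that s(2) by (intro meeting_time_le) auto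
    moreover have "collision_time T n X own \<omega> \<le> meeting_time T X I J \<omega>"
      using that by (intro collision_time_le) auto
    ultimately have "ennreal s \<le> ennreal s'" using s(1) by simp
    then show ?thesis using that(2) s(2) by simp
  qed
  have "X a s \<omega> < X b s \<omega>"
    using early[of a _ b] own ne lt s(2) by (intro order_kept) fastforce+
  moreover have "X b s \<omega> < X a' s \<omega>"
    using early[of b _ a'] own ne eq lt s(2) by (intro order_kept) fastforce+
  ultimately show False using eq by simp
qed

text \<open>Monotonicity of the owner map can fail in between: if particles 0, 1, 2 meet at one
  instant and priority merges 0 into 2 first, the owners become 2, 1, 2. The invariant kept instead
  says that inverted owners meet exactly at the current collision time, so their collision is still
  pending. For the new map, inverted owners share a position at the old collision time
  \<open>s\<close>, and since the collision time cannot have dropped below \<open>s\<close>, both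
  times equal \<open>s\<close>.\<close>

lemma collide_inversions:
  assumes own: "own \<in> owners n"
    and inv: "\<And>i j. i \<le> j \<Longrightarrow> j < n \<Longrightarrow> own j < own i \<Longrightarrow>
      meeting_time T X (own j) (own i) \<omega> = collision_time T n X own \<omega> \<and> collision_time T n X own \<omega> \<noteq> \<infinity>"
    and own': "own' = collide T n pr X \<omega> own" and ij: "i \<le> j" "j < n" "own' j < own' i"
  shows "meeting_time T X (own' j) (own' i) \<omega> = collision_time T n X own' \<omega> \<and>
    collision_time T n X own' \<omega> \<noteq> \<infinity>"
proof (cases "next_collisions T n pr X \<omega> own = {}")
  case True
  then show ?thesis using inv ij own' by (simp add: collide_no_collision)
next
  case False
  then obtain I J where IJ: "(I, J) \<in> next_collisions T n pr X \<omega> own"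
    and merge: "own' = (\<lambda>j. if own j = J then I else own j)"
    unfolding own' by (rule collide_collision)
  note IJ = IJ[unfolded next_collisions_iff]
  define s where "s = enn2real (collision_time T n X own \<omega>)"
  have ct: "collision_time T n X own \<omega> = ennreal s"
    using IJ by (simp add: s_def less_top)
  have "ennreal s \<le> ennreal T" using collision_time_le_T[of T n X own \<omega>] IJ ct by simp
  moreover have "0 \<le> s" by (simp add: s_def)
  ultimately have s: "s \<in> {0..T}" using T_nonneg by simp
  have lt: "a < n" if "a \<in> own ` {..<n}" for a using owners_image[OF own] that by auto
  have XIJ: "X I s \<omega> = X J s \<omega>"
    using IJ lt ct s by (intro meet') auto
  have i: "i < n" using ij by simp
  have act: "own i \<in> own ` {..<n}" "own j \<in> own ` {..<n}" using i ij by auto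
  have inv_ij: "X (own j) s \<omega> = X (own i) s \<omega>" if "own j < own i"
    using inv[OF ij(1,2) that] ct lt act s by (intro meet') auto
  have "X (own' j) s \<omega> = X (own' i) s \<omega>"
  \<comment> \<open>If exactly one owner was replaced, either the pair was inverted before, or the
    other owner has its index strictly between \<open>I\<close> and \<open>J\<close>, which are at
    one place at time \<open>s\<close>, and \<open>between\<close> applies.\<close>
  proof (cases "own i = J"; cases "own j = J")
    assume "own i = J" "own j \<noteq> J"
    then show ?thesis
      using between[OF own, of J "own j" I s] inv_ij IJ act ct s XIJ ij(3)
      by (cases "own j < J") (auto simp: merge)
  next
    assume "own i \<noteq> J" "own j = J"
    then show ?thesis
      using between[OF own, of I "own i" J s] inv_ij IJ act ct s XIJ ij(3)
      by (cases "J < own i") (auto simp: merge)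
  qed (use ij(3) inv_ij in \<open>auto simp: merge\<close>)
  then have "meeting_time T X (own' j) (own' i) \<omega> \<le> ennreal s"
    using s by (intro meeting_time_le)
  moreover have "ennreal s \<le> collision_time T n X own' \<omega>"
    unfolding ct[symmetric] own' by (rule collision_time_mono[OF collide_image_subset])
  moreover have "collision_time T n X own' \<omega> \<le> meeting_time T X (own' j) (own' i) \<omega>"
    using i ij by (intro collision_time_le) auto
  ultimately show ?thesis by (auto simp: top_unique)
qed

lemma funpow_collide_inversions:
  assumes "i \<le> j" "j < n" and "own = (collide T n pr X \<omega> ^^ m) id" and "own j < own i"
  shows "meeting_time T X (own j) (own i) \<omega> = collision_time T n X own \<omega> \<and>
    collision_time T n X own \<omega> \<noteq> \<infinity>"
  using assms
proof (induction m arbitrary: i j own)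
  case (Suc m)
  define own0 where "own0 = (collide T n pr X \<omega> ^^ m) id"
  have own: "own = collide T n pr X \<omega> own0" unfolding Suc.prems(3) own0_def by (simp only: funpow.simps o_apply)
  have "own0 \<in> owners n" unfolding own0_def by (rule funpow_collide_owners[OF id_owners])
  then show ?case
    by (rule collide_inversions[OF _ Suc.IH[OF _ _ own0_def] own Suc.prems(1,2,4)])
qed simp

context
  fixes pr :: "nat \<Rightarrow> nat" assumes pr: "inj_on pr {..<n}"
begin

lemma collision_time_final_own: "collision_time T n X (final_own T n pr X \<omega>) \<omega> = \<infinity>"
  using next_collisions_final_own next_collisions_empty_iff[OF funpow_collide_owners[OF id_owners] pr]
  unfolding final_own_def by fast

text \<open>An inversion would require a finite collision time, and no collision is pending for the
  final owner map.\<close>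

lemma final_own_mono: "i \<le> j \<Longrightarrow> j < n \<Longrightarrow> final_own T n pr X \<omega> i \<le> final_own T n pr X \<omega> j"
  using funpow_collide_inversions[OF _ _ final_own_def, of i j] collision_time_final_own
  by (rule_tac ccontr) simp

lemma final_own_owners: "final_own T n pr X \<omega> \<in> owners n"
  unfolding final_own_def by (rule funpow_collide_owners[OF id_owners])

lemma final_own_less_n: "j < n \<Longrightarrow> final_own T n pr X \<omega> j < n"
  using final_own_owners by (simp add: owners_def)

lemma final_own_separated:
  assumes "I \<in> final_own T n pr X \<omega> ` {..<n}" "J \<in> final_own T n pr X \<omega> ` {..<n}" "I < J"
  shows "X I T \<omega> < X J T \<omega>"
proof (rule order_kept)
  have "meeting_time T X I J \<omega> = \<infinity>"
    using collision_time_le[OF assms(1,2), of T X \<omega>] collision_time_final_own assms(3)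
    by (simp add: top_unique)
  then show "X I s \<omega> \<noteq> X J s \<omega>" if "s \<in> {0..T}" for s
    using meeting_time_le[OF that, of X I \<omega> J] by (auto simp: top_unique)
qed (use assms T_nonneg final_own_less_n in auto)

end

end

section \<open>From a monotone owner map to the coalescence pattern\<close>

lemma downset_eq_lessThan:
  fixes D :: "nat set"
  assumes "finite D" and "\<And>i j. i \<le> j \<Longrightarrow> j \<in> D \<Longrightarrow> i \<in> D"
  shows "D = {..<card D}"
proof (cases "D = {}")
  case False
  have "D = {..Max D}"
    using assms False by (auto intro: Max_in)
  then have "card D = Suc (Max D)" by (metis card_atMost)
  with \<open>D = {..Max D}\<close> show ?thesis by (simp add: lessThan_Suc_atMost)
qed simp

text \<open>This translates the pattern, coded by a sorted list of survivors and the sizes of their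
  clusters, into the condition produced by \<open>coalescence_sum_mono\<close>. As \<open>z\<close>
  increases strictly on the owners, sorting by position is sorting by index, and equal positions
  mean equal owners. As \<open>own\<close> is monotone, clusters are intervals, so their sizes in
  order determine them.\<close>

lemma (in composition) pattern_iff:
  fixes own :: "nat \<Rightarrow> nat" and z :: "nat \<Rightarrow> real"
  assumes A: "A \<subseteq> weyl_chamber \<nu> k"
    and mono: "\<And>i j. i \<le> j \<Longrightarrow> j < n \<Longrightarrow> own i \<le> own j"
    and sep: "\<And>I J. I \<in> own ` {..<n} \<Longrightarrow> J \<in> own ` {..<n} \<Longrightarrow> I < J \<Longrightarrow> z I < z J"
  defines "L \<equiv> sort_key z (sorted_list_of_set (own ` {..<n}))"
  shows "(map (\<lambda>I. card {j \<in> {..<n}. own j = I}) L = c \<and> (\<lambda>l\<in>{..<length L}. z (L ! l)) \<in> A) \<longleftrightarrow>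
    ((\<lambda>l\<in>{..<k}. z (own (start l))) \<in> A \<and> (\<forall>j<n. z (own j) = z (own (head j))))"
proof -
  have zinj: "z I = z J \<longleftrightarrow> I = J" if "I \<in> own ` {..<n}" "J \<in> own ` {..<n}" for I J
    using sep[of I J] sep[of J I] that by (cases I J rule: linorder_cases) auto
  have "sorted (map z (sorted_list_of_set (own ` {..<n})))"
    unfolding sorted_map
  proof (rule sorted_wrt_mono_rel[OF _ strict_sorted_list_of_set])
    fix I J assume "I \<in> set (sorted_list_of_set (own ` {..<n}))"
      "J \<in> set (sorted_list_of_set (own ` {..<n}))" "I < J"
    then show "z I \<le> z J" using sep[of I J] by simp
  qed
  then have L: "L = sorted_list_of_set (own ` {..<n})"
    unfolding L_def by (rule sort_key_id_if_sorted)
  have setL: "set L = own ` {..<n}" and sL: "sorted_wrt (<) L" unfolding L by auto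
  have nth_less: "L ! l < L ! m" if "l < m" "m < length L" for l m
    using sL that by (simp add: sorted_wrt_iff_nth_less)
  show ?thesis
  proof
    assume R: "(\<lambda>l\<in>{..<k}. z (own (start l))) \<in> A \<and> (\<forall>j<n. z (own j) = z (own (head j)))"
    then have oh: "own j = own (head j)" if "j < n" for j
      using zinj[of "own j" "own (head j)"] that head_less_n[OF that] by auto
    have less: "own (start l) < own (start m)" if "l < m" "m < k" for l m
    proof -
      have "z (own (start l)) < z (own (start m))"
        using R A that by (auto simp: weyl_chamber_def dest!: subsetD)
      moreover have "own (start l) \<le> own (start m)"
        using that by (intro mono start_le start_less_n) auto
      ultimately show ?thesis by (cases "own (start l) = own (start m)") auto
    qed
    have "set (map (\<lambda>l. own (start l)) [0..<k]) = own ` {..<n}"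
    proof (intro equalityI subsetI)
      fix I assume "I \<in> own ` {..<n}"
      then obtain j where "j < n" "I = own (head j)" using oh by auto
      then show "I \<in> set (map (\<lambda>l. own (start l)) [0..<k])" using block_of(1) by auto
    qed (use start_less_n in auto)
    moreover have "sorted_wrt (<) (map (\<lambda>l. own (start l)) [0..<k])"
      using less by (simp add: sorted_wrt_iff_nth_less)
    ultimately have Lmap: "L = map (\<lambda>l. own (start l)) [0..<k]"
      using sL setL by (intro strict_sorted_equal) auto
    \<comment> \<open>Owners are constant on blocks and differ between blocks, because the head
      positions increase strictly in \<open>A\<close>.\<close>
    have fiber: "{j \<in> {..<n}. own j = own (start l)} = {start l..<start (Suc l)}" if "l < k" for l
    proof -
      have bl: "block_of c j = l" if "j < n" "own j = own (start l)" for j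
        using less[of l "block_of c j"] less[of "block_of c j" l] oh[OF that(1)] that(2) \<open>l < k\<close>
          block_of(1)[OF that(1)] by (cases l "block_of c j" rule: linorder_cases) auto
      have "j < n" "own j = own (start l)" if "j \<in> {start l..<start (Suc l)}" for j
      proof -
        show "j < n" using that start_le[of "Suc l" k] start_length \<open>l < k\<close> by auto
        then show "own j = own (start l)" using oh block_of_eqI[OF \<open>l < k\<close>, of j] that by auto
      qed
      moreover have "j \<in> {start l..<start (Suc l)}" if "j < n" "own j = own (start l)" for j
        using block_of(2,3)[OF that(1)] bl[OF that] by simp
      ultimately show ?thesis by blast
    qed
    have "map (\<lambda>I. card {j \<in> {..<n}. own j = I}) L = c"
    proof (rule nth_equalityI)
      fix l assume "l < length (map (\<lambda>I. card {j \<in> {..<n}. own j = I}) L)"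
      then have l: "l < k" by (simp add: Lmap)
      then have "map (\<lambda>I. card {j \<in> {..<n}. own j = I}) L ! l = card {j \<in> {..<n}. own j = own (start l)}"
        by (simp add: Lmap)
      then show "map (\<lambda>I. card {j \<in> {..<n}. own j = I}) L ! l = c ! l"
        unfolding fiber[OF l] by (simp add: block_start_Suc l)
    qed (simp add: Lmap)
    moreover have "(\<lambda>l\<in>{..<length L}. z (L ! l)) = (\<lambda>l\<in>{..<k}. z (own (start l)))"
      by (auto simp: Lmap)
    ultimately show "map (\<lambda>I. card {j \<in> {..<n}. own j = I}) L = c \<and> (\<lambda>l\<in>{..<length L}. z (L ! l)) \<in> A"
      using R by simp
  next
    assume R: "map (\<lambda>I. card {j \<in> {..<n}. own j = I}) L = c \<and> (\<lambda>l\<in>{..<length L}. z (L ! l)) \<in> A"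
    then have len: "length L = k" by auto
    have fib: "card {j \<in> {..<n}. own j = L ! l} = c ! l" if "l < k" for l
    proof -
      have "map (\<lambda>I. card {j \<in> {..<n}. own j = I}) L ! l = card {j \<in> {..<n}. own j = L ! l}"
        using that len by simp
      then show ?thesis using R by simp
    qed
    \<comment> \<open>\<open>D l\<close> collects the clusters of the first \<open>l\<close>
      survivors. It is closed downwards by monotonicity and has as many elements as the first
      \<open>l\<close> blocks together, so it is the initial segment
      \<open>{..<start l}\<close>.\<close>
    define D where "D l = {j \<in> {..<n}. \<exists>l'<l. own j = L ! l'}" for l
    have D: "D l = {..<start l}" if "l \<le> k" for l
    proof -
      have "i \<in> D l" if ij: "i \<le> j" "j \<in> D l" for i j
      proof -
        obtain l' where l': "l' < l" "own j = L ! l'" "j < n" using ij(2) by (auto simp: D_def)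
        have "own i \<in> set L" using setL ij l' by auto
        then obtain m where m: "m < k" "own i = L ! m" using len by (auto simp: in_set_conv_nth)
        have "\<not> l' < m" using nth_less[of l' m] m len mono[OF ij(1) l'(3)] l'(2) by auto
        then show ?thesis using ij l' m by (auto simp: D_def intro!: exI[of _ m])
      qed
      moreover have fin: "finite (D l)" by (simp add: D_def)
      moreover have "card (D l) = start l"
      proof -
        have "D l = (\<Union>l'<l. {j \<in> {..<n}. own j = L ! l'})" by (auto simp: D_def)
        also have "card \<dots> = (\<Sum>l'<l. card {j \<in> {..<n}. own j = L ! l'})"
        proof (rule card_UN_disjoint)
          show "\<forall>i\<in>{..<l}. \<forall>j\<in>{..<l}. i \<noteq> j \<longrightarrow>
            {ja \<in> {..<n}. own ja = L ! i} \<inter> {ja \<in> {..<n}. own ja = L ! j} = {}"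
          proof (intro ballI impI)
            fix i j assume "i \<in> {..<l}" "j \<in> {..<l}" "i \<noteq> j"
            then have "L ! i \<noteq> L ! j"
              using nth_less[of i j] nth_less[of j i] \<open>l \<le> k\<close> len by (cases i j rule: linorder_cases) auto
            then show "{ja \<in> {..<n}. own ja = L ! i} \<inter> {ja \<in> {..<n}. own ja = L ! j} = {}" by auto
          qed
        qed auto
        also have "\<dots> = (\<Sum>l'<l. c ! l')" using \<open>l \<le> k\<close> fib by (intro sum.cong) auto
        also have "\<dots> = start l"
          using \<open>l \<le> k\<close> by (simp add: block_start_def sum_list_sum_nth atLeast0LessThan min_absorb2)
        finally show ?thesis .
      qed
      ultimately show ?thesis using downset_eq_lessThan[of "D l"] by metis
    qed
    have own: "own j = L ! block_of c j" if "j < n" for j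
    proof -
      note b = block_of[OF that]
      have "j \<in> D (Suc (block_of c j))" "j \<notin> D (block_of c j)" using D b by auto
      then show ?thesis by (auto simp: D_def less_Suc_eq)
    qed
    have "own (start l) = L ! l" if "l < k" for l
      using own[OF start_less_n[OF that]] that by simp
    moreover have "own j = own (head j)" if "j < n" for j
      using own[OF that] own[OF head_less_n[OF that]] block_of(1)[OF that] by simp
    ultimately show "(\<lambda>l\<in>{..<k}. z (own (start l))) \<in> A \<and> (\<forall>j<n. z (own j) = z (own (head j)))"
      using R len by (simp cong: restrict_cong)
  qed
qed

section \<open>Exchange of owners at a stopping time\<close>

locale karlin_mcgregor = prob_space M
  for M :: "'w measure" +
  fixes \<nu> :: "real measure" and T :: real and n :: nat
    and K :: "real \<Rightarrow> real \<Rightarrow> real \<Rightarrow> real measure"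
    and x :: "nat \<Rightarrow> real" and X :: "nat \<Rightarrow> real \<Rightarrow> 'w \<Rightarrow> real"
  assumes state_space: "\<nu> = lborel \<or> \<nu> = count_space \<int>"
    and T_pos: "0 < T"
    and kernels: "transition_kernels \<nu> T K"
    and start_in: "\<And>i. i < n \<Longrightarrow> x i \<in> space \<nu>"
    and KM1: "KM1 M \<nu> T n K X" and KM2: "KM2 M \<nu> T n K x X"
    and KM3: "KM3 M T n X" and KM4: "KM4 M \<nu> T n X"
begin

abbreviation states :: "(nat \<Rightarrow> real) measure" where "states \<equiv> joint_space n \<nu>"
abbreviation filt :: "ennreal \<Rightarrow> 'w measure" where
  "filt \<equiv> natural_filtration M states T (joint n X)"
abbreviation past :: "('w \<Rightarrow> ennreal) \<Rightarrow> 'w measure" where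
  "past \<equiv> filtration.pre_sigma (space M) filt"

lemma sigma_finite_\<nu>: "sigma_finite_measure \<nu>"
proof -
  have "countable (\<int> :: real set)" by (simp add: Ints_def)
  then show ?thesis
    using state_space lborel.sigma_finite_measure_axioms sigma_finite_measure_count_space_countable
    by metis
qed

lemma id_measurable_\<nu>: "(\<lambda>u. u) \<in> borel_measurable \<nu>"
  using state_space by (auto simp: measurable_def)

lemma zero_in_\<nu>: "0 \<in> space \<nu>"
  using state_space by auto

lemma X_measurable: "i < n \<Longrightarrow> t \<in> {0..T} \<Longrightarrow> X i t \<in> M \<rightarrow>\<^sub>M \<nu>"
  using KM2 unfolding KM2_def markov_process_def by blast

lemma X_in_space: "i < n \<Longrightarrow> t \<in> {0..T} \<Longrightarrow> \<omega> \<in> space M \<Longrightarrow> X i t \<omega> \<in> space \<nu>"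
  using measurable_space[OF X_measurable] .

lemma joint_measurable: "t \<in> {0..T} \<Longrightarrow> joint n X t \<in> M \<rightarrow>\<^sub>M states"
  unfolding joint_def[abs_def] by (intro measurable_restrict X_measurable) auto

lemma kernel_prob:
  assumes "s \<in> {0..T}" "z \<in> space \<nu>"
  shows "prob_space (K s T z)" "sets (K s T z) = sets \<nu>"
proof -
  have "K s T \<in> \<nu> \<rightarrow>\<^sub>M prob_algebra \<nu>" using kernels assms by (auto simp: transition_kernels_def)
  from measurable_space[OF this assms(2)]
  show "prob_space (K s T z)" "sets (K s T z) = sets \<nu>" by (auto simp: space_prob_algebra)
qed

lemma generators_subset:
  "{joint n X s -` B \<inter> space M | s B. s \<in> {0..T} \<and> ennreal s \<le> t \<and> B \<in> sets states} \<subseteq> Pow (space M)"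
  by auto

lemma space_filt: "space (filt t) = space M"
  unfolding natural_filtration_def by (rule space_measure_of[OF generators_subset])

lemma sets_filt: "sets (filt t) = sigma_sets (space M)
  {joint n X s -` B \<inter> space M | s B. s \<in> {0..T} \<and> ennreal s \<le> t \<and> B \<in> sets states}"
  unfolding natural_filtration_def by (rule sets_measure_of[OF generators_subset])

lemma sets_filt_subset: "sets (filt t) \<subseteq> sets M"
  unfolding sets_filt
  by (rule sets.sigma_sets_subset) (auto intro: measurable_sets[OF joint_measurable])

sublocale filt: filtration "space M" filt
proof
  show "space (filt t) = space M" for t by (rule space_filt)
  show "sets (filt i) \<subseteq> sets (filt j)" if "i \<le> j" for i j
    unfolding sets_filt by (rule sigma_sets_mono') (use that in \<open>auto intro: order_trans\<close>)
qed

lemma past_subset: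
  assumes "stopping_time filt \<sigma>"
  shows "sets (past \<sigma>) \<subseteq> sets M"
proof
  fix E assume "E \<in> sets (past \<sigma>)"
  then have "{\<omega> \<in> E. \<sigma> \<omega> \<le> \<top>} \<in> sets (filt \<top>)"
    by (rule filt.sets_pre_sigmaD[OF assms])
  then show "E \<in> sets M" using sets_filt_subset by auto
qed

lemma past_subalgebra:
  assumes "stopping_time filt \<sigma>"
  shows "finite_measure_subalgebra M (past \<sigma>)"
  by unfold_locales (use past_subset[OF assms] in \<open>simp add: subalgebra_def filt.space_pre_sigma\<close>)

lemma cond_law:
  assumes \<sigma>: "stopping_time filt \<sigma>" and B: "B \<in> sets states"
  shows "AE \<omega> in M. \<sigma> \<omega> \<le> ennreal T \<longrightarrow>
    real_cond_exp M (past \<sigma>) (indicator {\<omega> \<in> space M. joint n X T \<omega> \<in> B}) \<omega> =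
    measure (PiM {..<n} (\<lambda>i. K (enn2real (\<sigma> \<omega>)) T (X i (enn2real (\<sigma> \<omega>)) \<omega>))) B"
proof -
  have "AE \<omega> in M. \<sigma> \<omega> \<le> ennreal T \<longrightarrow>
    real_cond_exp M (past \<sigma>) (indicator {\<omega> \<in> space M. joint n X T \<omega> \<in> B}) \<omega> =
    measure (joint_kernels n K (enn2real (\<sigma> \<omega>)) T (joint n X (enn2real (\<sigma> \<omega>)) \<omega>)) B"
    using KM1 \<sigma> B T_pos unfolding KM1_def strong_markov_def by auto
  moreover have "joint_kernels n K s T (joint n X s \<omega>) = PiM {..<n} (\<lambda>i. K s T (X i s \<omega>))" for s \<omega>
    unfolding joint_kernels_def by (rule PiM_cong) (auto simp: joint_def)
  ultimately show ?thesis by simp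
qed

lemma event_measurable: "B \<in> sets states \<Longrightarrow> {\<omega> \<in> space M. joint n X T \<omega> \<in> B} \<in> sets M"
  using measurable_sets[OF joint_measurable, of T B] T_pos
  by (simp add: vimage_def Int_def conj_commute)

lemma integral_cond:
  assumes \<sigma>: "stopping_time filt \<sigma>" and B: "B \<in> sets states" and E: "E \<in> sets (past \<sigma>)"
  defines "I \<equiv> indicator {\<omega> \<in> space M. joint n X T \<omega> \<in> B} :: 'w \<Rightarrow> real"
  shows "(\<integral>\<omega>. indicator E \<omega> * I \<omega> \<partial>M) = (\<integral>\<omega>. indicator E \<omega> * real_cond_exp M (past \<sigma>) I \<omega> \<partial>M)"
    and "integrable M (\<lambda>\<omega>. indicator E \<omega> * I \<omega>)"
    and "integrable M (\<lambda>\<omega>. indicator E \<omega> * real_cond_exp M (past \<sigma>) I \<omega>)"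
proof -
  interpret S: finite_measure_subalgebra M "past \<sigma>" by (rule past_subalgebra[OF \<sigma>])
  have EM: "E \<in> sets M" using E past_subset[OF \<sigma>] by auto
  have I: "I \<in> borel_measurable M" unfolding I_def by (intro borel_measurable_indicator event_measurable B)
  show int: "integrable M (\<lambda>\<omega>. indicator E \<omega> * I \<omega>)"
  proof (rule integrable_const_bound[where B = 1])
    show "(\<lambda>\<omega>. indicator E \<omega> * I \<omega>) \<in> borel_measurable M"
      using EM by (intro borel_measurable_times I borel_measurable_indicator)
  qed (simp add: I_def indicator_def)
  have "(indicator E :: 'w \<Rightarrow> real) \<in> borel_measurable (past \<sigma>)" using E by simp
  from S.real_cond_exp_intg[OF int this I]
  show "(\<integral>\<omega>. indicator E \<omega> * I \<omega> \<partial>M) = (\<integral>\<omega>. indicator E \<omega> * real_cond_exp M (past \<sigma>) I \<omega> \<partial>M)"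
    and "integrable M (\<lambda>\<omega>. indicator E \<omega> * real_cond_exp M (past \<sigma>) I \<omega>)" by simp_all
qed

text \<open>This is the strong Markov property at the constant stopping time 0: the joint kernels
  are products, and the initial positions are almost surely the constants \<open>x i\<close>, so the
  conditional law is deterministic.\<close>

lemma law_joint: "distr M states (joint n X T) = PiM {..<n} (\<lambda>i. K 0 T (x i))"
proof (rule measure_eqI)
  have sets: "sets (PiM {..<n} (\<lambda>i. K 0 T (x i))) = sets states"
    using kernel_prob(2)[OF _ start_in] T_pos by (intro sets_PiM_cong) auto
  show "sets (distr M states (joint n X T)) = sets (PiM {..<n} (\<lambda>i. K 0 T (x i)))"
    by (simp add: sets)
  fix B assume "B \<in> sets (distr M states (joint n X T))"
  then have B: "B \<in> sets states" by simp
  \<comment> \<open>\<open>prob_space_PiM\<close> wants a probability measure at every index;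
    \<open>return \<nu> 0\<close> fills the indices from \<open>n\<close> on, which the product over
    \<open>{..<n}\<close> does not see.\<close>
  interpret Q: prob_space "PiM {..<n} (\<lambda>i. if i < n then K 0 T (x i) else return \<nu> 0)"
    using kernel_prob(1)[OF _ start_in] T_pos zero_in_\<nu> by (intro prob_space_PiM) (auto intro: prob_space_return)
  have "PiM {..<n} (\<lambda>i. if i < n then K 0 T (x i) else return \<nu> 0) = PiM {..<n} (\<lambda>i. K 0 T (x i))"
    by (rule PiM_cong) auto
  then interpret P: prob_space "PiM {..<n} (\<lambda>i. K 0 T (x i))" using Q.prob_space_axioms by simp
  let ?e = "{\<omega> \<in> space M. joint n X T \<omega> \<in> B}"
  let ?r = "real_cond_exp M (past (\<lambda>_. 0)) (indicator ?e)"
  have \<sigma>: "stopping_time filt (\<lambda>_. 0)" by (rule stopping_time_const)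
  have X0: "AE \<omega> in M. \<forall>i\<in>{..<n}. X i 0 \<omega> = x i"
    using KM2 by (intro AE_finite_allI) (auto simp: KM2_def)
  have "AE \<omega> in M. ?r \<omega> = measure (PiM {..<n} (\<lambda>i. K 0 T (x i))) B"
    using cond_law[OF \<sigma> B] X0
  proof eventually_elim
    case (elim \<omega>)
    have "PiM {..<n} (\<lambda>i. K 0 T (X i 0 \<omega>)) = PiM {..<n} (\<lambda>i. K 0 T (x i))"
      using elim(2) by (intro PiM_cong) auto
    with elim(1) show ?case by simp
  qed
  then have "(\<integral>\<omega>. ?r \<omega> \<partial>M) = measure (PiM {..<n} (\<lambda>i. K 0 T (x i))) B"
    by (subst integral_cong_AE[where g = "\<lambda>_. measure (PiM {..<n} (\<lambda>i. K 0 T (x i))) B"]) (auto simp: prob_space)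
  moreover have "(\<integral>\<omega>. ?r \<omega> \<partial>M) = measure M ?e"
  proof -
    have "space M \<in> sets (past (\<lambda>_. 0))" using sets.top[of "past (\<lambda>_. 0)"] by (simp add: filt.space_pre_sigma)
    from integral_cond(1)[OF \<sigma> B this]
    have "(\<integral>\<omega>. ?r \<omega> \<partial>M) = (\<integral>\<omega>. indicator ?e \<omega> \<partial>M)"
      by (simp cong: Bochner_Integration.integral_cong)
    then show ?thesis using event_measurable[OF B] by simp
  qed
  ultimately have "measure M ?e = measure (PiM {..<n} (\<lambda>i. K 0 T (x i))) B" by simp
  moreover have "joint n X T -` B \<inter> space M = ?e" by auto
  ultimately show "emeasure (distr M states (joint n X T)) B = emeasure (PiM {..<n} (\<lambda>i. K 0 T (x i))) B"
    using B joint_measurable[of T] T_pos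
    by (simp add: emeasure_distr emeasure_eq_measure P.emeasure_eq_measure)
qed

end

locale coalescing_particles = karlin_mcgregor M \<nu> T n K x X + composition c n
  for M :: "'w measure" and \<nu> T n K x X c +
  fixes A :: "(nat \<Rightarrow> real) set"
  assumes A_sets: "A \<in> sets (PiM {..<length c} (\<lambda>_. \<nu>))"
begin

text \<open>The map \<open>own\<close> is frozen: particle \<open>i\<close> is read at the terminal
  position of \<open>own i\<close>, as if no further collision took place before
  \<open>T\<close>.\<close>

definition final_sum :: "(nat \<Rightarrow> nat) \<Rightarrow> 'w \<Rightarrow> real" where
  "final_sum own \<omega> = coalescence_sum n c A (\<lambda>i. X (own i) T \<omega>)"

text \<open>The event on the columns is pulled back to the state of all \<open>n\<close> particles
  along \<open>q\<close>, which will be \<open>own \<circ> \<tau>\<close>, because the strong Markov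
  property speaks about the joint system.\<close>

definition cylinder :: "nat set \<Rightarrow> (nat \<Rightarrow> nat) \<Rightarrow> (nat \<Rightarrow> real) set" where
  "cylinder S q = {v \<in> space states. (\<lambda>j\<in>heads \<union> S. v (q j)) \<in> tail_event \<nu> A S}"

lemma tail_event_in_sets: "S \<subseteq> tails \<Longrightarrow> tail_event \<nu> A S \<in> sets (PiM (heads \<union> S) (\<lambda>_. \<nu>))"
  by (rule tail_event_sets[OF id_measurable_\<nu> A_sets])

lemma permuted_owner:
  assumes "own \<in> owners n" "\<tau> permutes {..<n}" "S \<subseteq> tails"
  shows "own \<circ> \<tau> \<in> heads \<union> S \<rightarrow> {..<n}"
proof
  fix j assume "j \<in> heads \<union> S"
  then have "\<tau> j < n" using assms(3) heads_subset tails_subset permutes_in_image[OF assms(2), of j] by auto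
  then show "(own \<circ> \<tau>) j \<in> {..<n}" using assms(1) by (simp add: owners_def)
qed

lemma cylinder_sets:
  assumes "S \<subseteq> tails" "q \<in> heads \<union> S \<rightarrow> {..<n}"
  shows "cylinder S q \<in> sets states"
proof -
  have "(\<lambda>v. \<lambda>j\<in>heads \<union> S. v (q j)) \<in> states \<rightarrow>\<^sub>M PiM (heads \<union> S) (\<lambda>_. \<nu>)"
    using assms by (intro measurable_restrict measurable_component_singleton) auto
  from measurable_sets[OF this tail_event_in_sets[OF assms(1)]]
  show ?thesis by (simp add: cylinder_def vimage_def Int_def conj_commute)
qed

text \<open>The cylinder depends on \<open>\<tau>\<close> only through
  \<open>own \<circ> \<tau>\<close>, so the terms with a repeated owner cancel by antisymmetry of
  \<open>tail_coeff\<close>. They must go before conditioning, since a repeated owner makes two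
  columns identical rather than independent.\<close>

lemma final_sum_expand:
  assumes own: "own \<in> owners n" and \<omega>: "\<omega> \<in> space M"
  shows "final_sum own \<omega> = (\<Sum>S\<in>Pow tails. \<Sum>\<tau> | \<tau> permutes {..<n} \<and> inj_on (own \<circ> \<tau>) (heads \<union> S).
    tail_coeff S \<tau> * indicator {\<omega> \<in> space M. joint n X T \<omega> \<in> cylinder S (own \<circ> \<tau>)} \<omega>)"
proof -
  have XT: "X i T \<omega> \<in> space \<nu>" if "i < n" for i
    using that \<omega> T_pos by (intro X_in_space) auto
  have "final_sum own \<omega> = (\<Sum>S\<in>Pow tails. \<Sum>\<tau> | \<tau> permutes {..<n}.
    tail_coeff S \<tau> * indicator (tail_event \<nu> A S) (\<lambda>j\<in>heads \<union> S. X (own (\<tau> j)) T \<omega>))"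
    unfolding final_sum_def by (rule coalescence_sum_expand) (use own XT in \<open>auto simp: owners_def\<close>)
  also have "\<dots> = (\<Sum>S\<in>Pow tails. \<Sum>\<tau> | \<tau> permutes {..<n}.
    tail_coeff S \<tau> * indicator (cylinder S (own \<circ> \<tau>)) (joint n X T \<omega>))"
  proof (intro sum.cong[OF refl])
    fix S \<tau> assume "S \<in> Pow tails" "\<tau> \<in> {\<tau>. \<tau> permutes {..<n}}"
    then have q: "own \<circ> \<tau> \<in> heads \<union> S \<rightarrow> {..<n}" by (intro permuted_owner own) auto
    have "(\<lambda>j\<in>heads \<union> S. joint n X T \<omega> ((own \<circ> \<tau>) j)) = (\<lambda>j\<in>heads \<union> S. X (own (\<tau> j)) T \<omega>)"
    proof (rule restrict_ext)
      fix j assume "j \<in> heads \<union> S"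
      then have "own (\<tau> j) < n" using q by (auto simp: Pi_def)
      then show "joint n X T \<omega> ((own \<circ> \<tau>) j) = X (own (\<tau> j)) T \<omega>" by (simp add: joint_def)
    qed
    moreover have "joint n X T \<omega> \<in> space states"
      using measurable_space[OF joint_measurable \<omega>] T_pos by simp
    ultimately show "tail_coeff S \<tau> * indicator (tail_event \<nu> A S) (\<lambda>j\<in>heads \<union> S. X (own (\<tau> j)) T \<omega>) =
      tail_coeff S \<tau> * indicator (cylinder S (own \<circ> \<tau>)) (joint n X T \<omega>)"
      by (simp add: cylinder_def indicator_def)
  qed
  also have "\<dots> = (\<Sum>S\<in>Pow tails. \<Sum>\<tau> | \<tau> permutes {..<n} \<and> inj_on (own \<circ> \<tau>) (heads \<union> S).
    tail_coeff S \<tau> * indicator (cylinder S (own \<circ> \<tau>)) (joint n X T \<omega>))"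
  proof (intro sum.cong[OF refl])
    fix S assume S: "S \<in> Pow tails"
    show "(\<Sum>\<tau> | \<tau> permutes {..<n}. tail_coeff S \<tau> * indicator (cylinder S (own \<circ> \<tau>)) (joint n X T \<omega>)) =
      (\<Sum>\<tau> | \<tau> permutes {..<n} \<and> inj_on (own \<circ> \<tau>) (heads \<union> S).
        tail_coeff S \<tau> * indicator (cylinder S (own \<circ> \<tau>)) (joint n X T \<omega>))"
      using S heads_subset tails_subset
      by (intro antisymmetric_sum_inj[where \<phi> = "\<lambda>q. indicator (cylinder S q) (joint n X T \<omega>)"] tail_coeff_transpose)
        auto
  qed
  finally show ?thesis using \<omega> by (simp add: indicator_def)
qed

text \<open>Injectivity of \<open>q\<close> means that distinct columns read distinct coordinates,
  which are independent under the product law.\<close>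

lemma measure_cylinder:
  assumes S: "S \<subseteq> tails" and q: "q \<in> heads \<union> S \<rightarrow> {..<n}" "inj_on q (heads \<union> S)"
    and s: "s \<in> {0..T}" and z: "\<And>i. i < n \<Longrightarrow> z i \<in> space \<nu>"
  shows "measure (PiM {..<n} (\<lambda>i. K s T (z i))) (cylinder S q) =
    measure (PiM (heads \<union> S) (\<lambda>j. K s T (z (q j)))) (tail_event \<nu> A S)"
proof -
  let ?U = "heads \<union> S"
  have sets_n: "sets (PiM {..<n} (\<lambda>i. K s T (z i))) = sets states"
    using kernel_prob(2)[OF s z] by (intro sets_PiM_cong) auto
  have sets_U: "sets (PiM ?U (\<lambda>j. K s T (z (q j)))) = sets (PiM ?U (\<lambda>_. \<nu>))"
    using kernel_prob(2)[OF s z] q(1) by (intro sets_PiM_cong) (auto simp: Pi_def)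
  have "(\<lambda>v. \<lambda>j\<in>?U. v (q j)) \<in> PiM {..<n} (\<lambda>i. K s T (z i)) \<rightarrow>\<^sub>M PiM ?U (\<lambda>j. K s T (z (q j)))"
    using q(1) by (intro measurable_restrict measurable_component_singleton) auto
  moreover have "distr (PiM {..<n} (\<lambda>i. K s T (z i))) (PiM ?U (\<lambda>j. K s T (z (q j)))) (\<lambda>v. \<lambda>j\<in>?U. v (q j)) =
    PiM ?U (\<lambda>j. K s T (z (q j)))"
    using kernel_prob(1)[OF s z] by (intro distr_PiM_reindex q) auto
  ultimately have "measure (PiM ?U (\<lambda>j. K s T (z (q j)))) (tail_event \<nu> A S) =
    measure (PiM {..<n} (\<lambda>i. K s T (z i)))
      ((\<lambda>v. \<lambda>j\<in>?U. v (q j)) -` tail_event \<nu> A S \<inter> space (PiM {..<n} (\<lambda>i. K s T (z i))))"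
    using tail_event_in_sets[OF S] sets_U by (metis measure_distr)
  moreover have "(\<lambda>v. \<lambda>j\<in>?U. v (q j)) -` tail_event \<nu> A S \<inter> space (PiM {..<n} (\<lambda>i. K s T (z i))) = cylinder S q"
    using sets_eq_imp_space_eq[OF sets_n] by (auto simp: cylinder_def)
  ultimately show ?thesis by simp
qed

text \<open>By the strong Markov property the conditional expectation of the final sum given the past of
  \<open>\<sigma>\<close> depends on the owner map only through the positions of the owners at time \<open>\<sigma>\<close>.\<close>

lemma final_sum_exchange:
  assumes \<sigma>: "stopping_time filt \<sigma>" and E: "E \<in> sets (past \<sigma>)"
    and ET: "\<And>\<omega>. \<omega> \<in> E \<Longrightarrow> \<sigma> \<omega> \<le> ennreal T"
    and own: "own \<in> owners n" "own' \<in> owners n"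
    and same: "AE \<omega> in M. \<omega> \<in> E \<longrightarrow>
      (\<forall>i<n. X (own i) (enn2real (\<sigma> \<omega>)) \<omega> = X (own' i) (enn2real (\<sigma> \<omega>)) \<omega>)"
  shows "(\<integral>\<omega>. indicator E \<omega> * final_sum own \<omega> \<partial>M) = (\<integral>\<omega>. indicator E \<omega> * final_sum own' \<omega> \<partial>M)"
proof -
  define r where "r B = real_cond_exp M (past \<sigma>) (indicator {\<omega> \<in> space M. joint n X T \<omega> \<in> B})" for B
  let ?perms = "\<lambda>own S. {\<tau>. \<tau> permutes {..<n} \<and> inj_on (own \<circ> \<tau>) (heads \<union> S)}"
  \<comment> \<open>By linearity \<open>H own\<close> is a version of the conditional expectation of
    \<open>final_sum own\<close> given the past of \<open>\<sigma>\<close>, written with conditional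
    probabilities of cylinders.\<close>
  define H where "H own \<omega> = (\<Sum>S\<in>Pow tails. \<Sum>\<tau>\<in>?perms own S. tail_coeff S \<tau> * r (cylinder S (own \<circ> \<tau>)) \<omega>)"
    for own \<omega>
  have EM: "E \<in> sets M" using E past_subset[OF \<sigma>] by auto
  have r_meas: "r B \<in> borel_measurable M" for B unfolding r_def by simp
  then have H_meas: "H own \<in> borel_measurable M" for own
    unfolding H_def by (intro borel_measurable_sum borel_measurable_times) auto
  have to_H: "(\<integral>\<omega>. indicator E \<omega> * final_sum own \<omega> \<partial>M) = (\<integral>\<omega>. indicator E \<omega> * H own \<omega> \<partial>M)"
    if own: "own \<in> owners n" for own
  proof -
    let ?e = "\<lambda>S \<tau>. indicator {\<omega> \<in> space M. joint n X T \<omega> \<in> cylinder S (own \<circ> \<tau>)} :: 'w \<Rightarrow> real"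
    have cyl: "cylinder S (own \<circ> \<tau>) \<in> sets states" if "S \<in> Pow tails" "\<tau> \<in> ?perms own S" for S \<tau>
      using that by (intro cylinder_sets permuted_owner own) auto
    have "(\<integral>\<omega>. indicator E \<omega> * final_sum own \<omega> \<partial>M) =
      (\<integral>\<omega>. (\<Sum>S\<in>Pow tails. \<Sum>\<tau>\<in>?perms own S. tail_coeff S \<tau> * (indicator E \<omega> * ?e S \<tau> \<omega>)) \<partial>M)"
      by (intro Bochner_Integration.integral_cong[OF refl])
        (simp add: final_sum_expand[OF own] sum_distrib_left mult.left_commute)
    also have "\<dots> = (\<Sum>S\<in>Pow tails. \<Sum>\<tau>\<in>?perms own S. tail_coeff S \<tau> * (\<integral>\<omega>. indicator E \<omega> * ?e S \<tau> \<omega> \<partial>M))"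
      by (subst Bochner_Integration.integral_sum, (intro Bochner_Integration.integrable_sum integrable_mult_right integral_cond(2)[OF \<sigma> cyl E]; assumption),
        intro sum.cong[OF refl], subst Bochner_Integration.integral_sum,
        (intro integrable_mult_right integral_cond(2)[OF \<sigma> cyl E]; assumption), simp)
    also have "\<dots> = (\<Sum>S\<in>Pow tails. \<Sum>\<tau>\<in>?perms own S. tail_coeff S \<tau> *
        (\<integral>\<omega>. indicator E \<omega> * r (cylinder S (own \<circ> \<tau>)) \<omega> \<partial>M))"
      unfolding r_def by (intro sum.cong[OF refl] arg_cong2[where f = "(*)", OF refl] integral_cond(1)[OF \<sigma> cyl E])
    also have "\<dots> = (\<integral>\<omega>. (\<Sum>S\<in>Pow tails. \<Sum>\<tau>\<in>?perms own S.
        tail_coeff S \<tau> * (indicator E \<omega> * r (cylinder S (own \<circ> \<tau>)) \<omega>)) \<partial>M)"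
      unfolding r_def
      by (subst Bochner_Integration.integral_sum, (intro Bochner_Integration.integrable_sum integrable_mult_right integral_cond(3)[OF \<sigma> cyl E]; assumption),
        intro sum.cong[OF refl], subst Bochner_Integration.integral_sum,
        (intro integrable_mult_right integral_cond(3)[OF \<sigma> cyl E]; assumption), simp)
    also have "\<dots> = (\<integral>\<omega>. indicator E \<omega> * H own \<omega> \<partial>M)"
      by (simp add: H_def sum_distrib_left mult.left_commute)
    finally show ?thesis .
  qed
  have law: "AE \<omega> in M. \<forall>S\<in>Pow tails. \<forall>\<tau>\<in>?perms own S. \<sigma> \<omega> \<le> ennreal T \<longrightarrow>
      r (cylinder S (own \<circ> \<tau>)) \<omega> =
      measure (PiM {..<n} (\<lambda>i. K (enn2real (\<sigma> \<omega>)) T (X i (enn2real (\<sigma> \<omega>)) \<omega>))) (cylinder S (own \<circ> \<tau>))"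
    if own: "own \<in> owners n" for own
    unfolding r_def
  proof (intro AE_finite_allI)
    show "finite (?perms own S)" for S
      by (rule finite_subset[OF _ finite_permutations[of "{..<n}"]]) auto
    fix S \<tau> assume "S \<in> Pow tails" "\<tau> \<in> ?perms own S"
    then have "cylinder S (own \<circ> \<tau>) \<in> sets states" by (intro cylinder_sets permuted_owner own) auto
    then show "AE \<omega> in M. \<sigma> \<omega> \<le> ennreal T \<longrightarrow>
      real_cond_exp M (past \<sigma>) (indicator {\<omega> \<in> space M. joint n X T \<omega> \<in> cylinder S (own \<circ> \<tau>)}) \<omega> =
      measure (PiM {..<n} (\<lambda>i. K (enn2real (\<sigma> \<omega>)) T (X i (enn2real (\<sigma> \<omega>)) \<omega>))) (cylinder S (own \<circ> \<tau>))"
      by (rule cond_law[OF \<sigma>])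
  qed simp
  have "AE \<omega> in M. indicator E \<omega> * H own \<omega> = indicator E \<omega> * H own' \<omega>"
    using law[OF own(1)] law[OF own(2)] same AE_space
  proof eventually_elim
    case (elim \<omega>)
    show ?case
    proof (cases "\<omega> \<in> E")
      case True
      define s where "s = enn2real (\<sigma> \<omega>)"
      have "\<sigma> \<omega> < \<top>" using ET[OF True] ennreal_less_top by (rule le_less_trans)
      then have "ennreal s = \<sigma> \<omega>" by (simp add: s_def)
      then have "ennreal s \<le> ennreal T" using ET[OF True] by simp
      then have s: "s \<in> {0..T}" using T_pos by (simp add: s_def)
      define z where "z i = X i s \<omega>" for i
      have z: "z i \<in> space \<nu>" if "i < n" for i
        unfolding z_def using that s elim(4) by (rule X_in_space)
      \<comment> \<open>The columns are taken independent with starting points \<open>a j\<close>,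
        even where these coincide or come from one owner; so \<open>\<Phi>\<close> is meaningful for
        every permutation.\<close>
      define \<Phi> where "\<Phi> S a = measure (PiM (heads \<union> S) (\<lambda>j. K s T (a j))) (tail_event \<nu> A S)" for S a
      have H_eq: "H own \<omega> = (\<Sum>S\<in>Pow tails. \<Sum>\<tau> | \<tau> permutes {..<n}. tail_coeff S \<tau> * \<Phi> S (z \<circ> own \<circ> \<tau>))"
        if own: "own \<in> owners n" and
          law: "\<forall>S\<in>Pow tails. \<forall>\<tau>\<in>?perms own S. \<sigma> \<omega> \<le> ennreal T \<longrightarrow>
            r (cylinder S (own \<circ> \<tau>)) \<omega> =
            measure (PiM {..<n} (\<lambda>i. K (enn2real (\<sigma> \<omega>)) T (X i (enn2real (\<sigma> \<omega>)) \<omega>))) (cylinder S (own \<circ> \<tau>))"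
        for own
        unfolding H_def
      proof (intro sum.cong[OF refl])
        fix S assume S: "S \<in> Pow tails"
        have "(\<Sum>\<tau>\<in>?perms own S. tail_coeff S \<tau> * r (cylinder S (own \<circ> \<tau>)) \<omega>) =
          (\<Sum>\<tau>\<in>?perms own S. tail_coeff S \<tau> * \<Phi> S (z \<circ> (own \<circ> \<tau>)))"
        proof (intro sum.cong[OF refl] arg_cong2[where f = "(*)", OF refl])
          fix \<tau> assume \<tau>: "\<tau> \<in> ?perms own S"
          then have "r (cylinder S (own \<circ> \<tau>)) \<omega> = measure (PiM {..<n} (\<lambda>i. K s T (z i))) (cylinder S (own \<circ> \<tau>))"
            using law S ET[OF True] by (simp add: s_def z_def)
          also have "\<dots> = measure (PiM (heads \<union> S) (\<lambda>j. K s T (z ((own \<circ> \<tau>) j)))) (tail_event \<nu> A S)"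
            using S \<tau> by (intro measure_cylinder permuted_owner own s z) simp_all
          also have "\<dots> = \<Phi> S (z \<circ> (own \<circ> \<tau>))" by (simp add: \<Phi>_def)
          finally show "r (cylinder S (own \<circ> \<tau>)) \<omega> = \<Phi> S (z \<circ> (own \<circ> \<tau>))" .
        qed
        \<comment> \<open>The cancellation is used in the opposite direction: the terms with
          repeated owners sum to zero also with \<open>\<Phi>\<close>, so they may be added. The
          range of summation no longer depends on \<open>own\<close>, which enters through
          \<open>z \<circ> own\<close> alone.\<close>
        also have "\<dots> = (\<Sum>\<tau> | \<tau> permutes {..<n}. tail_coeff S \<tau> * \<Phi> S (z \<circ> (own \<circ> \<tau>)))"
          using S heads_subset tails_subset
          by (intro antisymmetric_sum_inj[where \<phi> = "\<lambda>q. \<Phi> S (z \<circ> q)", symmetric] tail_coeff_transpose) auto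
        finally show "(\<Sum>\<tau>\<in>?perms own S. tail_coeff S \<tau> * r (cylinder S (own \<circ> \<tau>)) \<omega>) =
          (\<Sum>\<tau> | \<tau> permutes {..<n}. tail_coeff S \<tau> * \<Phi> S (z \<circ> own \<circ> \<tau>))" by (simp add: comp_assoc)
      qed
      have "\<Phi> S (z \<circ> own \<circ> \<tau>) = \<Phi> S (z \<circ> own' \<circ> \<tau>)" if "S \<in> Pow tails" "\<tau> permutes {..<n}" for S \<tau>
      proof -
        have "(z \<circ> own \<circ> \<tau>) j = (z \<circ> own' \<circ> \<tau>) j" if "j \<in> heads \<union> S" for j
        proof -
          have "\<tau> j < n"
            using that \<open>S \<in> Pow tails\<close> heads_subset tails_subset permutes_in_image[OF \<open>\<tau> permutes _\<close>, of j] by auto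
          then show ?thesis using elim(3) True by (simp add: z_def s_def)
        qed
        then show ?thesis unfolding \<Phi>_def by (metis (no_types, lifting) PiM_cong)
      qed
      then show ?thesis
        unfolding H_eq[OF own(1) elim(1)] H_eq[OF own(2) elim(2)] by simp
    qed simp
  qed
  then have "(\<integral>\<omega>. indicator E \<omega> * H own \<omega> \<partial>M) = (\<integral>\<omega>. indicator E \<omega> * H own' \<omega> \<partial>M)"
    using EM H_meas by (intro integral_cong_AE) auto
  then show ?thesis by (simp add: to_H own)
qed

end

section \<open>Expectations and events\<close>

lemma stopping_time_INF:
  fixes f :: "'i \<Rightarrow> 'w \<Rightarrow> ennreal"
  assumes "finite S" "\<And>i. i \<in> S \<Longrightarrow> stopping_time F (f i)"
  shows "stopping_time F (\<lambda>\<omega>. INF i\<in>S. f i \<omega>)"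
  using assms
proof (induction S rule: finite_induct)
  case empty
  then show ?case by (simp add: stopping_time_const)
next
  case (insert i S)
  then have "stopping_time F (\<lambda>\<omega>. min (f i \<omega>) (INF i\<in>S. f i \<omega>))"
    by (intro stopping_time_min) auto
  then show ?case by (simp add: inf_min)
qed

section \<open>Measurability of sorting by random keys\<close>

lemma insort_key_cong:
  "(\<And>y. y \<in> insert x (set xs) \<Longrightarrow> f y = g y) \<Longrightarrow> insort_key f x xs = insort_key g x xs"
  by (induction xs) auto

lemma sort_key_cong: "(\<And>y. y \<in> set xs \<Longrightarrow> f y = g y) \<Longrightarrow> sort_key f xs = sort_key g xs"
proof (induction xs)
  case (Cons x xs)
  then have "sort_key f xs = sort_key g xs" by simp
  with Cons.prems show ?case by (simp, intro insort_key_cong) auto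
qed simp

lemma measurable_insort_key:
  fixes f :: "'w \<Rightarrow> nat \<Rightarrow> real"
  assumes [measurable]: "\<And>i. (\<lambda>\<omega>. f \<omega> i) \<in> borel_measurable M"
  shows "(\<lambda>\<omega>. insort_key (f \<omega>) x xs) \<in> M \<rightarrow>\<^sub>M count_space UNIV"
proof (induction xs)
  case (Cons y ys)
  note Cons.IH [measurable]
  have "(\<lambda>\<omega>. if f \<omega> x \<le> f \<omega> y then x # y # ys else y # insort_key (f \<omega>) x ys) \<in> M \<rightarrow>\<^sub>M count_space UNIV"
    by measurable
  then show ?case by simp
qed simp

lemma measurable_sort_key:
  fixes f :: "'w \<Rightarrow> nat \<Rightarrow> real"
  assumes "\<And>i. (\<lambda>\<omega>. f \<omega> i) \<in> borel_measurable M"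
  shows "(\<lambda>\<omega>. sort_key (f \<omega>) xs) \<in> M \<rightarrow>\<^sub>M count_space UNIV"
proof (induction xs)
  case (Cons x xs)
  have "(\<lambda>\<omega>. insort_key (f \<omega>) x (sort_key (f \<omega>) xs)) \<in> M \<rightarrow>\<^sub>M count_space UNIV"
    by (rule measurable_compose_countable[OF measurable_insort_key[OF assms] Cons.IH])
  then show ?case by simp
qed simp

section \<open>The determinant as an expectation over independent particles\<close>

context coalescing_particles
begin

text \<open>In the Leibniz formula with columns as factors, column \<open>j\<close> meets row
  \<open>\<tau> j\<close>; the product splits into density and distribution-function columns, the
  former numbered by blocks.\<close>

lemma det_coalescence_matrix:
  "Determinant.det (coalescence_matrix \<nu> P p n c x y) =
    (\<Sum>\<tau> | \<tau> permutes {..<n}. signof \<tau> * ((\<Prod>l<k. p (x (\<tau> (start l))) (y l)) *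
      (\<Prod>j\<in>tails. measure (P (x (\<tau> j))) {u \<in> space \<nu>. u \<le> y (block_of c j)} - of_bool (\<tau> j < j))))"
proof -
  let ?m = "coalescence_matrix \<nu> P p n c x y"
  have entry: "?m $$ (\<tau> j, j) = (if head j = j then p (x (\<tau> j)) (y (block_of c j))
      else measure (P (x (\<tau> j))) {u \<in> space \<nu>. u \<le> y (block_of c j)} - of_bool (\<tau> j < j))"
    if "\<tau> permutes {..<n}" "j < n" for \<tau> j
    using that permutes_in_image[OF that(1), of j]
    by (auto simp: coalescence_matrix_def dist_fun_def Let_def)
  have "(\<Prod>j<n. ?m $$ (\<tau> j, j)) = (\<Prod>l<k. p (x (\<tau> (start l))) (y l)) *
      (\<Prod>j\<in>tails. measure (P (x (\<tau> j))) {u \<in> space \<nu>. u \<le> y (block_of c j)} - of_bool (\<tau> j < j))"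
    if \<tau>: "\<tau> permutes {..<n}" for \<tau>
  proof -
    have "(\<Prod>j<n. ?m $$ (\<tau> j, j)) = (\<Prod>j\<in>heads. ?m $$ (\<tau> j, j)) * (\<Prod>j\<in>tails. ?m $$ (\<tau> j, j))"
      unfolding heads_tails(2)[symmetric] by (rule prod.union_disjoint) (simp_all add: heads_tails(1))
    also have "(\<Prod>j\<in>heads. ?m $$ (\<tau> j, j)) = (\<Prod>l<k. p (x (\<tau> (start l))) (y l))"
      unfolding heads_def prod.reindex[OF inj_start] o_apply
      by (intro prod.cong) (auto simp: entry[OF \<tau>] start_less_n)
    also have "(\<Prod>j\<in>tails. ?m $$ (\<tau> j, j)) =
      (\<Prod>j\<in>tails. measure (P (x (\<tau> j))) {u \<in> space \<nu>. u \<le> y (block_of c j)} - of_bool (\<tau> j < j))"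
      by (intro prod.cong) (auto simp: entry[OF \<tau>] tails_def)
    finally show ?thesis .
  qed
  then show ?thesis
    by (subst det_col[of _ n]) (auto simp: coalescence_matrix_def lessThan_atLeast0 intro!: sum.cong)
qed

text \<open>For fixed \<open>\<tau>\<close> column \<open>j\<close> is served by the independent
  particle \<open>\<tau> j\<close>, so \<open>integral_heads_tails\<close> applies with
  \<open>b j = [\<tau> j < j]\<close>. The signed sum of the results is the Leibniz formula under
  the integral.\<close>

lemma expectation_final_sum_id:
  assumes p: "\<And>i. i < n \<Longrightarrow> p (x i) \<in> borel_measurable \<nu>"
      "\<And>i u. i < n \<Longrightarrow> u \<in> space \<nu> \<Longrightarrow> 0 \<le> p (x i) u"
    and dens: "\<And>i. i < n \<Longrightarrow> K 0 T (x i) = density \<nu> (\<lambda>u. ennreal (p (x i) u))"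
  shows "(\<integral>\<omega>. final_sum id \<omega> \<partial>M) =
    (LINT y:A | PiM {..<k} (\<lambda>_. \<nu>). Determinant.det (coalescence_matrix \<nu> (K 0 T) p n c x y))"
proof -
  \<comment> \<open>The second branch only supplies a probability measure at indices without a
    particle.\<close>
  define \<mu> where "\<mu> i = (if i < n then K 0 T (x i) else return \<nu> 0)" for i
  have prob: "prob_space (\<mu> i)" for i
    using kernel_prob(1)[OF _ start_in] T_pos zero_in_\<nu> by (auto simp: \<mu>_def intro: prob_space_return)
  have sets_\<mu>: "sets (\<mu> i) = sets \<nu>" for i
    using kernel_prob(2)[OF _ start_in] T_pos by (auto simp: \<mu>_def)
  have law: "distr M states (joint n X T) = PiM {..<n} \<mu>"
    unfolding law_joint by (rule PiM_cong) (auto simp: \<mu>_def)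
  \<comment> \<open>The terminal positions are listed by column instead of by particle; as
    \<open>\<tau>\<close> is injective on \<open>{..<n}\<close>, they are independent with laws
    \<open>\<mu> (\<tau> j)\<close>.\<close>
  define Y where "Y \<tau> \<omega> = (\<lambda>j\<in>{..<n}. X (\<tau> j) T \<omega>)" for \<tau> :: "nat \<Rightarrow> nat" and \<omega>
  define h :: "(nat \<Rightarrow> nat) \<Rightarrow> (nat \<Rightarrow> real) \<Rightarrow> real" where "h \<tau> v = indicator A (\<lambda>l\<in>{..<k}. v (start l)) *
    (\<Prod>j\<in>tails. of_bool (v j \<le> v (head j)) - of_bool (\<tau> j < j))" for \<tau> v
  define g :: "(nat \<Rightarrow> nat) \<Rightarrow> (nat \<Rightarrow> real) \<Rightarrow> real" where "g \<tau> y = indicator A y * ((\<Prod>l<k. p (x (\<tau> (start l))) (y l)) *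
    (\<Prod>j\<in>tails. measure (\<mu> (\<tau> j)) {u \<in> space \<nu>. u \<le> y (block_of c j)} - of_bool (\<tau> j < j)))" for \<tau> y
  let ?Q = "\<lambda>\<tau>. PiM {..<n} (\<lambda>j. \<mu> (\<tau> j))"
  have \<tau>_less: "\<tau> j < n" if "\<tau> permutes {..<n}" "j < n" for \<tau> j
    using permutes_in_image[OF that(1), of j] that(2) by simp
  have Q: "Y \<tau> \<in> M \<rightarrow>\<^sub>M ?Q \<tau>" "distr M (?Q \<tau>) (Y \<tau>) = ?Q \<tau>" if \<tau>: "\<tau> permutes {..<n}" for \<tau>
  proof -
    have re: "(\<lambda>v. \<lambda>j\<in>{..<n}. v (\<tau> j)) \<in> PiM {..<n} \<mu> \<rightarrow>\<^sub>M ?Q \<tau>"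
      using \<tau>_less[OF \<tau>] by (intro measurable_restrict measurable_component_singleton) auto
    have jm: "joint n X T \<in> M \<rightarrow>\<^sub>M PiM {..<n} \<mu>"
      using joint_measurable[of T] T_pos
      by (simp add: measurable_cong_sets[OF refl sets_PiM_cong[OF refl sets_\<mu>]])
    have Y: "Y \<tau> = (\<lambda>v. \<lambda>j\<in>{..<n}. v (\<tau> j)) \<circ> joint n X T"
      using \<tau>_less[OF \<tau>] by (auto simp: Y_def joint_def fun_eq_iff)
    show "Y \<tau> \<in> M \<rightarrow>\<^sub>M ?Q \<tau>" unfolding Y by (rule measurable_comp[OF jm re])
    have "distr M (PiM {..<n} \<mu>) (joint n X T) = PiM {..<n} \<mu>"
      unfolding law[symmetric] by (rule distr_cong) simp_all
    then have "distr M (?Q \<tau>) (Y \<tau>) = distr (PiM {..<n} \<mu>) (?Q \<tau>) (\<lambda>v. \<lambda>j\<in>{..<n}. v (\<tau> j))"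
      unfolding Y using distr_distr[OF re jm] by simp
    also have "\<dots> = ?Q \<tau>"
      using \<tau>_less[OF \<tau>] permutes_inj_on[OF \<tau>] by (intro distr_PiM_reindex prob) auto
    finally show "distr M (?Q \<tau>) (Y \<tau>) = ?Q \<tau>" .
  qed
  have heads_tails_integral: "integral\<^sup>L (?Q \<tau>) (h \<tau>) = integral\<^sup>L (PiM {..<k} (\<lambda>_. \<nu>)) (g \<tau>)"
    "integrable (PiM {..<k} (\<lambda>_. \<nu>)) (g \<tau>)" "integrable (?Q \<tau>) (h \<tau>)"
    if \<tau>: "\<tau> permutes {..<n}" for \<tau>
    unfolding h_def[abs_def] g_def[abs_def]
    using \<tau>_less[OF \<tau>] p dens
    by (intro integral_heads_tails[where p = "\<lambda>j. p (x (\<tau> j))"] sigma_finite_\<nu> id_measurable_\<nu> A_sets prob sets_\<mu>;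
        simp add: \<mu>_def)+
  have int_hY: "integrable M (\<lambda>\<omega>. h \<tau> (Y \<tau> \<omega>))" "(\<integral>\<omega>. h \<tau> (Y \<tau> \<omega>) \<partial>M) = integral\<^sup>L (?Q \<tau>) (h \<tau>)"
    if \<tau>: "\<tau> permutes {..<n}" for \<tau>
  proof -
    have "integrable (distr M (?Q \<tau>) (Y \<tau>)) (h \<tau>)" using Q(2)[OF \<tau>] heads_tails_integral(3)[OF \<tau>] by simp
    then show "integrable M (\<lambda>\<omega>. h \<tau> (Y \<tau> \<omega>))" by (rule integrable_distr[OF Q(1)[OF \<tau>]])
    show "(\<integral>\<omega>. h \<tau> (Y \<tau> \<omega>) \<partial>M) = integral\<^sup>L (?Q \<tau>) (h \<tau>)"
      using integral_distr[OF Q(1)[OF \<tau>], of "h \<tau>"] Q(2)[OF \<tau>] heads_tails_integral(3)[OF \<tau>] by simp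
  qed
  have "final_sum id \<omega> = (\<Sum>\<tau> | \<tau> permutes {..<n}. signof \<tau> * h \<tau> (Y \<tau> \<omega>))" for \<omega>
    unfolding final_sum_def coalescence_sum_def
  proof (intro sum.cong[OF refl])
    fix \<tau> assume "\<tau> \<in> {\<tau>. \<tau> permutes {..<n}}"
    have "(\<lambda>l\<in>{..<k}. X (id (\<tau> (start l))) T \<omega>) = (\<lambda>l\<in>{..<k}. Y \<tau> \<omega> (start l))"
      by (rule restrict_ext) (simp add: Y_def start_less_n)
    moreover have "(\<Prod>j\<in>tails. of_bool (X (id (\<tau> j)) T \<omega> \<le> X (id (\<tau> (head j))) T \<omega>) - of_bool (\<tau> j < j)) =
      (\<Prod>j\<in>tails. of_bool (Y \<tau> \<omega> j \<le> Y \<tau> \<omega> (head j)) - of_bool (\<tau> j < j) :: real)"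
      by (rule prod.cong) (auto simp: Y_def tails_def head_less_n)
    ultimately show "signof \<tau> * indicator A (\<lambda>l\<in>{..<k}. X (id (\<tau> (start l))) T \<omega>) *
      (\<Prod>j\<in>tails. of_bool (X (id (\<tau> j)) T \<omega> \<le> X (id (\<tau> (head j))) T \<omega>) - of_bool (\<tau> j < j)) =
      signof \<tau> * h \<tau> (Y \<tau> \<omega>)" by (simp add: h_def)
  qed
  then have "(\<integral>\<omega>. final_sum id \<omega> \<partial>M) = (\<Sum>\<tau> | \<tau> permutes {..<n}. signof \<tau> * (\<integral>\<omega>. h \<tau> (Y \<tau> \<omega>) \<partial>M))"
    using int_hY(1) by (simp add: Bochner_Integration.integral_sum)
  also have "\<dots> = (\<Sum>\<tau> | \<tau> permutes {..<n}. signof \<tau> * integral\<^sup>L (PiM {..<k} (\<lambda>_. \<nu>)) (g \<tau>))"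
    using int_hY(2) heads_tails_integral(1) by simp
  also have "\<dots> = (\<integral>y. (\<Sum>\<tau> | \<tau> permutes {..<n}. signof \<tau> * g \<tau> y) \<partial>PiM {..<k} (\<lambda>_. \<nu>))"
    using heads_tails_integral(2) by (simp add: Bochner_Integration.integral_sum)
  also have "(\<lambda>y. \<Sum>\<tau> | \<tau> permutes {..<n}. signof \<tau> * g \<tau> y) =
    (\<lambda>y. indicator A y *\<^sub>R Determinant.det (coalescence_matrix \<nu> (K 0 T) p n c x y))"
  proof
    fix y
    have "(\<Prod>j\<in>tails. measure (\<mu> (\<tau> j)) {u \<in> space \<nu>. u \<le> y (block_of c j)} - of_bool (\<tau> j < j)) =
      (\<Prod>j\<in>tails. measure (K 0 T (x (\<tau> j))) {u \<in> space \<nu>. u \<le> y (block_of c j)} - of_bool (\<tau> j < j) :: real)"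
      if "\<tau> permutes {..<n}" for \<tau>
      using \<tau>_less[OF that] by (intro prod.cong) (auto simp: \<mu>_def tails_def)
    then show "(\<Sum>\<tau> | \<tau> permutes {..<n}. signof \<tau> * g \<tau> y) =
      indicator A y *\<^sub>R Determinant.det (coalescence_matrix \<nu> (K 0 T) p n c x y)"
      unfolding det_coalescence_matrix g_def by (simp add: sum_distrib_left mult.left_commute)
  qed
  finally show ?thesis unfolding set_lebesgue_integral_def .
qed

lemma final_sum_integrable:
  assumes "own \<in> owners n"
  shows "integrable M (final_sum own)"
proof -
  have "integrable M (\<lambda>\<omega>. \<Sum>S\<in>Pow tails. \<Sum>\<tau> | \<tau> permutes {..<n} \<and> inj_on (own \<circ> \<tau>) (heads \<union> S).
    tail_coeff S \<tau> * indicator {\<omega> \<in> space M. joint n X T \<omega> \<in> cylinder S (own \<circ> \<tau>)} \<omega>)"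
    by (intro Bochner_Integration.integrable_sum integrable_mult_right integrable_real_indicator
        event_measurable cylinder_sets permuted_owner assms) (auto simp: emeasure_eq_measure)
  then show ?thesis
    by (rule Bochner_Integration.integrable_cong[THEN iffD1, rotated 2])
      (simp_all add: final_sum_expand[OF assms])
qed

section \<open>Collisions and owner maps as events of the past\<close>

lemma stopping_time_meeting:
  "I < n \<Longrightarrow> J < n \<Longrightarrow> I \<noteq> J \<Longrightarrow> stopping_time filt (meeting_time T X I J)"
proof -
  have "stopping_time filt (meeting_time T X I J)" if "I < J" "J < n" for I J
    using KM4 that by (auto simp: KM4_def)
  from this[of I J] this[of J I] show "I < n \<Longrightarrow> J < n \<Longrightarrow> I \<noteq> J \<Longrightarrow> ?thesis"
    using meeting_time_commute[of T X I J, abs_def] by (metis ext linorder_neqE_nat meeting_time_commute)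
qed

lemma stopping_time_collision:
  assumes "own \<in> owners n"
  shows "stopping_time filt (collision_time T n X own)"
proof -
  have "stopping_time filt (\<lambda>\<omega>. INF p\<in>{(I, J). I \<in> own ` {..<n} \<and> J \<in> own ` {..<n} \<and> I < J}.
    (case p of (I, J) \<Rightarrow> meeting_time T X I J \<omega>))"
  proof (rule stopping_time_INF[OF finite_active_pairs])
    fix p assume "p \<in> {(I, J). I \<in> own ` {..<n} \<and> J \<in> own ` {..<n} \<and> I < J}"
    then obtain I J where p: "p = (I, J)" and *: "I \<in> own ` {..<n}" "J \<in> own ` {..<n}" "I < J" by blast
    then have "I < n" "J < n" "I \<noteq> J" using owners_image[OF assms] by auto
    then have "stopping_time filt (meeting_time T X I J)" by (rule stopping_time_meeting)
    then show "stopping_time filt (\<lambda>\<omega>. case p of (I, J) \<Rightarrow> meeting_time T X I J \<omega>)" by (simp add: p)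
  qed
  then show ?thesis unfolding collision_time_def[abs_def] .
qed

text \<open>An active pair never meets before the collision time, so attaining it is the complement
  of a strict inequality between two stopping times, which is an event of the past of the smaller
  one. The case of an infinite collision time is removed.\<close>

lemma collision_event:
  assumes own: "own \<in> owners n"
  shows "{\<omega> \<in> space M. (I, J) \<in> next_collisions T n pr X \<omega> own} \<in> sets (past (collision_time T n X own))"
proof (cases "I \<in> own ` {..<n} \<and> J \<in> own ` {..<n} \<and> pr I < pr J")
  case True
  let ?\<sigma> = "collision_time T n X own"
  note \<sigma> = stopping_time_collision[OF own]
  have ne: "I \<noteq> J" and "I < n" "J < n" using True owners_image[OF own] by auto
  then have "Measurable.pred (past ?\<sigma>) (\<lambda>\<omega>. ?\<sigma> \<omega> < meeting_time T X I J \<omega>)"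
    by (intro filt.stopping_time_less \<sigma> stopping_time_meeting)
  then have less: "{\<omega> \<in> space M. ?\<sigma> \<omega> < meeting_time T X I J \<omega>} \<in> sets (past ?\<sigma>)"
    by (simp add: pred_def filt.space_pre_sigma)
  have "?\<sigma> -` {\<infinity>} \<inter> space (past ?\<sigma>) \<in> sets (past ?\<sigma>)"
    by (rule measurable_sets[OF filt.measurable_stopping_time_pre_sigma[OF \<sigma>]]) simp
  with less have "space (past ?\<sigma>) - ({\<omega> \<in> space M. ?\<sigma> \<omega> < meeting_time T X I J \<omega>} \<union> (?\<sigma> -` {\<infinity>} \<inter> space (past ?\<sigma>)))
    \<in> sets (past ?\<sigma>)" by blast
  also have "space (past ?\<sigma>) - ({\<omega> \<in> space M. ?\<sigma> \<omega> < meeting_time T X I J \<omega>} \<union> (?\<sigma> -` {\<infinity>} \<inter> space (past ?\<sigma>))) =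
    {\<omega> \<in> space M. (I, J) \<in> next_collisions T n pr X \<omega> own}"
    using True ne collision_time_le[of I own n J T X]
    by (auto simp: next_collisions_iff filt.space_pre_sigma not_less intro: antisym)
  finally show ?thesis .
next
  case False
  then have "{\<omega> \<in> space M. (I, J) \<in> next_collisions T n pr X \<omega> own} = {}"
    by (auto simp: next_collisions_iff)
  then show ?thesis by (simp only: sets.empty_sets)
qed

text \<open>The new map depends on \<open>\<omega>\<close> only through the set of next collisions,
  a subset of the finite set \<open>{..<n} \<times> {..<n}\<close>; the event is a finite union over
  the possible values of that set.\<close>

lemma collide_event:
  assumes own: "own \<in> owners n"
  shows "{\<omega> \<in> space M. collide T n pr X \<omega> own = own'} \<in> sets (past (collision_time T n X own))"
proof -
  let ?F = "past (collision_time T n X own)"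
  let ?C = "\<lambda>\<omega>. next_collisions T n pr X \<omega> own"
  let ?P = "{..<n} \<times> {..<n}"
  define g where "g C = (if C = {} then own
      else let I = arg_min_on pr (fst ` C); J = arg_min_on pr {J. (I, J) \<in> C}
           in (\<lambda>j. if own j = J then I else own j))" for C
  have CP: "?C \<omega> \<subseteq> ?P" for \<omega>
    using own by (auto simp: next_collisions_iff owners_def)
  have "{\<omega> \<in> space ?F. q \<in> ?C \<omega> \<longleftrightarrow> q \<in> D} \<in> sets ?F" for q D
  proof -
    have "{\<omega> \<in> space ?F. q \<in> ?C \<omega>} \<in> sets ?F"
      using collision_event[OF own, of "fst q" "snd q" pr] by (simp add: filt.space_pre_sigma)
    then show ?thesis by (cases "q \<in> D") (auto simp: set_diff_eq[symmetric] intro: sets.sets_Collect_neg)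
  qed
  then have "{\<omega> \<in> space ?F. \<exists>D\<in>{D \<in> Pow ?P. g D = own'}. \<forall>q\<in>?P. q \<in> ?C \<omega> \<longleftrightarrow> q \<in> D} \<in> sets ?F"
    by (intro sets.sets_Collect_finite_Ex sets.sets_Collect_finite_All) auto
  also have "{\<omega> \<in> space ?F. \<exists>D\<in>{D \<in> Pow ?P. g D = own'}. \<forall>q\<in>?P. q \<in> ?C \<omega> \<longleftrightarrow> q \<in> D} =
    {\<omega> \<in> space M. collide T n pr X \<omega> own = own'}"
    unfolding filt.space_pre_sigma
  proof (rule Collect_cong, rule conj_cong[OF refl])
    fix \<omega>
    have "(\<exists>D\<in>{D \<in> Pow ?P. g D = own'}. \<forall>q\<in>?P. q \<in> ?C \<omega> \<longleftrightarrow> q \<in> D) \<longleftrightarrow> g (?C \<omega>) = own'"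
    proof
      assume "\<exists>D\<in>{D \<in> Pow ?P. g D = own'}. \<forall>q\<in>?P. q \<in> ?C \<omega> \<longleftrightarrow> q \<in> D"
      then obtain D where D: "D \<subseteq> ?P" "g D = own'" "\<forall>q\<in>?P. q \<in> ?C \<omega> \<longleftrightarrow> q \<in> D" by blast
      then have "D = ?C \<omega>" using CP[of \<omega>] by blast
      with D show "g (?C \<omega>) = own'" by simp
    qed (use CP[of \<omega>] in blast)
    then show "(\<exists>D\<in>{D \<in> Pow ?P. g D = own'}. \<forall>q\<in>?P. q \<in> ?C \<omega> \<longleftrightarrow> q \<in> D) \<longleftrightarrow>
      collide T n pr X \<omega> own = own'"
      by (simp add: collide_def g_def Let_def)
  qed
  finally show ?thesis .
qed

text \<open>By induction on \<open>m\<close>, the event of reaching \<open>own'\<close> splits by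
  the previous map and the collision that follows it. Both are events of the past of an earlier
  collision time, and that past is contained in the one for \<open>own'\<close>.\<close>

lemma owner_event:
  assumes "own \<in> owners n"
  shows "{\<omega> \<in> space M. (collide T n pr X \<omega> ^^ m) id = own} \<in> sets (past (collision_time T n X own))"
  using assms
proof (induction m arbitrary: own)
  case 0
  have "{\<omega> \<in> space M. (collide T n pr X \<omega> ^^ 0) id = own} =
    (if id = own then space (past (collision_time T n X own)) else {})"
    by (simp add: filt.space_pre_sigma)
  then show ?case by (simp only: sets.top sets.empty_sets split: if_split) simp
next
  case (Suc m own')
  let ?own = "\<lambda>m \<omega>. (collide T n pr X \<omega> ^^ m) id"
  \<comment> \<open>Only maps with a larger active set can precede \<open>own'\<close>; for these
    \<open>collision_time_mono\<close> compares the two stopping times.\<close>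
  let ?O = "{own \<in> owners n. own' ` {..<n} \<subseteq> own ` {..<n}}"
  have "{\<omega> \<in> space M. ?own m \<omega> = own} \<inter> {\<omega> \<in> space M. collide T n pr X \<omega> own = own'}
    \<in> sets (past (collision_time T n X own'))" if "own \<in> ?O" for own
  proof -
    have "{\<omega> \<in> space M. ?own m \<omega> = own} \<inter> {\<omega> \<in> space M. collide T n pr X \<omega> own = own'}
      \<in> sets (past (collision_time T n X own))"
      using that by (intro sets.Int Suc.IH collide_event) auto
    moreover have "sets (past (collision_time T n X own)) \<subseteq> sets (past (collision_time T n X own'))"
      using that Suc.prems by (intro filt.mono_pre_sigma stopping_time_collision collision_time_mono) auto
    ultimately show ?thesis by blast
  qed
  then have "(\<Union>own\<in>?O. {\<omega> \<in> space M. ?own m \<omega> = own} \<inter> {\<omega> \<in> space M. collide T n pr X \<omega> own = own'})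
    \<in> sets (past (collision_time T n X own'))"
    using finite_owners by (intro sets.finite_UN) auto
  also have "(\<Union>own\<in>?O. {\<omega> \<in> space M. ?own m \<omega> = own} \<inter> {\<omega> \<in> space M. collide T n pr X \<omega> own = own'}) =
    {\<omega> \<in> space M. ?own (Suc m) \<omega> = own'}"
  proof (intro equalityI subsetI)
    fix \<omega> assume \<omega>: "\<omega> \<in> {\<omega> \<in> space M. ?own (Suc m) \<omega> = own'}"
    have "?own m \<omega> \<in> ?O"
      using \<omega> collide_image_subset[of T n pr X \<omega> "?own m \<omega>"] funpow_collide_owners[OF id_owners] by auto
    then show "\<omega> \<in> (\<Union>own\<in>?O. {\<omega> \<in> space M. ?own m \<omega> = own} \<inter> {\<omega> \<in> space M. collide T n pr X \<omega> own = own'})"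
      by (rule UN_I) (use \<omega> in simp)
  qed auto
  finally show ?case .
qed

lemma AE_ordered: "AE \<omega> in M. ordered_trajectories T n X \<omega>"
proof -
  let ?P = "{(I, J). I < J \<and> J < n}"
  have fin: "finite ?P" by (rule finite_subset[of _ "{..<n} \<times> {..<n}"]) auto
  have "AE \<omega> in M. \<forall>q\<in>?P. \<forall>t\<in>{0..T}. (\<forall>s\<in>{0..t}. X (fst q) s \<omega> \<noteq> X (snd q) s \<omega>) \<longrightarrow>
      X (fst q) t \<omega> < X (snd q) t \<omega>"
    using KM3 unfolding KM3_def by - (rule AE_finite_allI[OF fin], auto)
  moreover have "AE \<omega> in M. \<forall>q\<in>?P. meeting_time T X (fst q) (snd q) \<omega> \<noteq> \<infinity> \<longrightarrow>
      X (fst q) (enn2real (meeting_time T X (fst q) (snd q) \<omega>)) \<omega> =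
      X (snd q) (enn2real (meeting_time T X (fst q) (snd q) \<omega>)) \<omega>"
    using KM4 unfolding KM4_def by - (rule AE_finite_allI[OF fin], auto)
  ultimately show ?thesis
  proof eventually_elim
    case (elim \<omega>)
    show ?case
    proof
      fix I J t assume "I < J" "J < n" "t \<in> {0..T}" "\<And>s. s \<in> {0..t} \<Longrightarrow> X I s \<omega> \<noteq> X J s \<omega>"
      then show "X I t \<omega> < X J t \<omega>" using elim(1)[rule_format, of "(I, J)" t] by simp
    next
      fix I J assume "I < J" "J < n" "meeting_time T X I J \<omega> \<noteq> \<infinity>"
      then show "X I (enn2real (meeting_time T X I J \<omega>)) \<omega> = X J (enn2real (meeting_time T X I J \<omega>)) \<omega>"
        using elim(2)[rule_format, of "(I, J)"] by simp
    qed (use T_pos in simp)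
  qed
qed


section \<open>Invariance of the expectation under one collision\<close>

abbreviation owner_after :: "(nat \<Rightarrow> nat) \<Rightarrow> nat \<Rightarrow> 'w \<Rightarrow> nat \<Rightarrow> nat" where
  "owner_after pr m \<omega> \<equiv> (collide T n pr X \<omega> ^^ m) id"

text \<open>Pairs are used because the exchange of owners is stated for two fixed maps. For each
  \<open>m\<close> these finitely many events partition the sample space according to the maps
  before and after the next step.\<close>

definition step_event :: "(nat \<Rightarrow> nat) \<Rightarrow> nat \<Rightarrow> (nat \<Rightarrow> nat) \<times> (nat \<Rightarrow> nat) \<Rightarrow> 'w set" where
  "step_event pr m q = {\<omega> \<in> space M. owner_after pr m \<omega> = fst q} \<inter>
     {\<omega> \<in> space M. collide T n pr X \<omega> (fst q) = snd q}"

lemma step_event_past: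
  "q \<in> owners n \<times> owners n \<Longrightarrow> step_event pr m q \<in> sets (past (collision_time T n X (fst q)))"
  unfolding step_event_def by (intro sets.Int owner_event collide_event) auto

lemma sum_step_event:
  assumes "\<omega> \<in> space M"
  shows "(\<Sum>q\<in>owners n \<times> owners n. indicator (step_event pr m q) \<omega> * f q) =
    (f (owner_after pr m \<omega>, owner_after pr (Suc m) \<omega>) :: real)"
proof -
  let ?q = "(owner_after pr m \<omega>, owner_after pr (Suc m) \<omega>)"
  have "?q \<in> owners n \<times> owners n" by (intro SigmaI) (rule funpow_collide_owners[OF id_owners])+
  moreover have "indicator (step_event pr m q) \<omega> * f q = (if q = ?q then f q else 0)" for q
    using assms by (auto simp: step_event_def indicator_def prod_eq_iff)
  ultimately show ?thesis using finite_owners[of n] by (simp add: sum.delta)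
qed

lemma integrable_step:
  assumes "q \<in> owners n \<times> owners n" "own \<in> owners n"
  shows "integrable M (\<lambda>\<omega>. indicator (step_event pr m q) \<omega> * final_sum own \<omega>)"
proof -
  have "step_event pr m q \<in> sets M"
    by (rule subsetD[OF past_subset[OF stopping_time_collision] step_event_past[OF assms(1)]])
      (use assms(1) in auto)
  then have "integrable M (\<lambda>\<omega>. final_sum own \<omega> * indicator (step_event pr m q) \<omega>)"
    by (intro integrable_real_mult_indicator final_sum_integrable assms)
  then show ?thesis by (simp add: mult.commute)
qed

text \<open>The two maps differ only where the loser is replaced by the winner, and these two are at
  one place at the collision time. The event belongs to the past of that time, so
  \<open>final_sum_exchange\<close> applies.\<close>

lemma expectation_step:
  assumes q: "q \<in> owners n \<times> owners n"
  shows "(\<integral>\<omega>. indicator (step_event pr m q) \<omega> * final_sum (fst q) \<omega> \<partial>M) =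
    (\<integral>\<omega>. indicator (step_event pr m q) \<omega> * final_sum (snd q) \<omega> \<partial>M)"
\<comment> \<open>Equal maps cover all steps without a collision. If the maps differ, a collision
  occurs on the whole event, so the collision time is finite there and at most
  \<open>T\<close>.\<close>
proof (cases "fst q = snd q")
  case False
  let ?\<sigma> = "collision_time T n X (fst q)"
  have own: "fst q \<in> owners n" "snd q \<in> owners n" using q by auto
  have collision: "\<exists>I J. (I, J) \<in> next_collisions T n pr X \<omega> (fst q) \<and>
      snd q = (\<lambda>j. if fst q j = J then I else fst q j)"
    if \<omega>: "\<omega> \<in> step_event pr m q" for \<omega>
  proof -
    have col: "collide T n pr X \<omega> (fst q) = snd q" using \<omega> by (simp add: step_event_def)
    then have "next_collisions T n pr X \<omega> (fst q) \<noteq> {}" using False collide_no_collision by metis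
    then show ?thesis by (rule collide_collision) (use col in auto)
  qed
  have fin: "?\<sigma> \<omega> \<noteq> \<infinity>" if "\<omega> \<in> step_event pr m q" for \<omega>
    using collision[OF that] by (auto simp: next_collisions_iff)
  show ?thesis
  proof (rule final_sum_exchange[OF stopping_time_collision[OF own(1)] step_event_past[OF q] _ own])
    show "?\<sigma> \<omega> \<le> ennreal T" if "\<omega> \<in> step_event pr m q" for \<omega>
      using fin[OF that] by (rule collision_time_le_T)
    show "AE \<omega> in M. \<omega> \<in> step_event pr m q \<longrightarrow>
      (\<forall>i<n. X (fst q i) (enn2real (?\<sigma> \<omega>)) \<omega> = X (snd q i) (enn2real (?\<sigma> \<omega>)) \<omega>)"
      using AE_ordered
    proof eventually_elim
      case (elim \<omega>)
      then interpret ordered_trajectories T n X \<omega> .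
      show ?case
      proof
        assume \<omega>: "\<omega> \<in> step_event pr m q"
        then obtain I J where IJ: "(I, J) \<in> next_collisions T n pr X \<omega> (fst q)"
          "snd q = (\<lambda>j. if fst q j = J then I else fst q j)" using collision by blast
        have "I < n" "J < n" using IJ(1) owners_image[OF own(1)] by (auto simp: next_collisions_iff owners_def)
        moreover have "meeting_time T X I J \<omega> = ennreal (enn2real (?\<sigma> \<omega>))"
          using IJ(1) by (auto simp: next_collisions_iff less_top)
        ultimately have "X I (enn2real (?\<sigma> \<omega>)) \<omega> = X J (enn2real (?\<sigma> \<omega>)) \<omega>"
          by (rule meet') simp
        then show "\<forall>i<n. X (fst q i) (enn2real (?\<sigma> \<omega>)) \<omega> = X (snd q i) (enn2real (?\<sigma> \<omega>)) \<omega>"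
          by (simp add: IJ(2))
      qed
    qed
  qed
qed simp

lemma expectation_final_sum_Suc:
  "(\<integral>\<omega>. final_sum (owner_after pr (Suc m) \<omega>) \<omega> \<partial>M) = (\<integral>\<omega>. final_sum (owner_after pr m \<omega>) \<omega> \<partial>M)"
proof -
  let ?O = "owners n \<times> owners n"
  have "(\<integral>\<omega>. final_sum (owner_after pr (Suc m) \<omega>) \<omega> \<partial>M) =
    (\<integral>\<omega>. (\<Sum>q\<in>?O. indicator (step_event pr m q) \<omega> * final_sum (snd q) \<omega>) \<partial>M)"
    by (intro Bochner_Integration.integral_cong[OF refl], subst sum_step_event) simp_all
  also have "\<dots> = (\<Sum>q\<in>?O. \<integral>\<omega>. indicator (step_event pr m q) \<omega> * final_sum (snd q) \<omega> \<partial>M)"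
    by (rule Bochner_Integration.integral_sum) (auto intro: integrable_step)
  also have "\<dots> = (\<Sum>q\<in>?O. \<integral>\<omega>. indicator (step_event pr m q) \<omega> * final_sum (fst q) \<omega> \<partial>M)"
    by (rule sum.cong[OF refl], rule expectation_step[symmetric])
  also have "\<dots> = (\<integral>\<omega>. (\<Sum>q\<in>?O. indicator (step_event pr m q) \<omega> * final_sum (fst q) \<omega>) \<partial>M)"
    by (rule Bochner_Integration.integral_sum[symmetric]) (auto intro: integrable_step)
  also have "\<dots> = (\<integral>\<omega>. final_sum (owner_after pr m \<omega>) \<omega> \<partial>M)"
    by (intro Bochner_Integration.integral_cong[OF refl], subst sum_step_event) simp_all
  finally show ?thesis .
qed

lemma expectation_final_own:
  "(\<integral>\<omega>. final_sum (final_own T n pr X \<omega>) \<omega> \<partial>M) = (\<integral>\<omega>. final_sum id \<omega> \<partial>M)"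
proof -
  have "(\<integral>\<omega>. final_sum (owner_after pr m \<omega>) \<omega> \<partial>M) = (\<integral>\<omega>. final_sum id \<omega> \<partial>M)" for m
  proof (induction m)
    case (Suc m)
    then show ?case by (simp only: expectation_final_sum_Suc)
  qed (simp only: funpow.simps id_apply)
  then show ?thesis unfolding final_own_def .
qed

lemma final_sum_final_own_measurable:
  "(\<lambda>\<omega>. final_sum (final_own T n pr X \<omega>) \<omega>) \<in> borel_measurable M"
proof (rule measurable_cong[THEN iffD1])
  \<comment> \<open>The step after the last one serves only as a partition by its first component,
    which is the final owner map.\<close>
  show "(\<Sum>q\<in>owners n \<times> owners n. indicator (step_event pr n q) \<omega> * final_sum (fst q) \<omega>) =
    final_sum (final_own T n pr X \<omega>) \<omega>" if "\<omega> \<in> space M" for \<omega>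
    using that by (subst sum_step_event) (simp_all add: final_own_def)
  show "(\<lambda>\<omega>. \<Sum>q\<in>owners n \<times> owners n. indicator (step_event pr n q) \<omega> * final_sum (fst q) \<omega>)
    \<in> borel_measurable M"
    by (intro borel_measurable_sum borel_measurable_integrable integrable_step) auto
qed

section \<open>The coalescence event and its probability\<close>

definition coalescence_event :: "(nat \<Rightarrow> nat) \<Rightarrow> 'w set" where
  "coalescence_event pr = {\<omega> \<in> space M. coalescence_pattern T n pr X \<omega> = c \<and>
     survivor_positions T n pr X \<omega> \<in> A}"

text \<open>The event is a finite union over the final owner map and the list of survivors of length
  \<open>k\<close>; with both fixed, only the measurable positions at time \<open>T\<close>
  enter.\<close>

lemma coalescence_event_sets: "coalescence_event pr \<in> sets M"
proof -
  \<comment> \<open>The measurability of sorting needs a measurable key for every index, so the key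
    is set to 0 where there is no particle; survivors have indices below \<open>n\<close>, where
    nothing changes.\<close>
  define f :: "'w \<Rightarrow> nat \<Rightarrow> real" where "f \<omega> i = (if i < n then X i T \<omega> else 0)" for \<omega> i
  have f_meas: "(\<lambda>\<omega>. f \<omega> i) \<in> borel_measurable M" for i
    using measurable_compose[OF X_measurable id_measurable_\<nu>, of i T] T_pos by (cases "i < n") (auto simp: f_def)
  let ?sorted = "\<lambda>own \<omega>. sort_key (f \<omega>) (sorted_list_of_set (own ` {..<n}))"
  let ?L = "{L. set L \<subseteq> {..<n} \<and> length L = k}"
  let ?size = "\<lambda>own I. card {j \<in> {..<n}. own j = I}"
  let ?E = "\<lambda>own L. {\<omega> \<in> space M. final_own T n pr X \<omega> = own} \<inter> {\<omega> \<in> space M. ?sorted own \<omega> = L} \<inter>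
    {\<omega> \<in> space M. (\<lambda>l\<in>{..<k}. X (L ! l) T \<omega>) \<in> A}"
  have E_sets: "?E own L \<in> sets M" if "own \<in> owners n" "L \<in> ?L" for own L
  proof (intro sets.Int)
    show "{\<omega> \<in> space M. final_own T n pr X \<omega> = own} \<in> sets M"
      using owner_event[OF that(1), where pr = pr and m = n] past_subset[OF stopping_time_collision[OF that(1)]]
      by (auto simp: final_own_def)
    show "{\<omega> \<in> space M. ?sorted own \<omega> = L} \<in> sets M"
      using measurable_sets[OF measurable_sort_key[where f = f, OF f_meas, where xs = "sorted_list_of_set (own ` {..<n})"], of "{L}"]
      by (simp add: vimage_def Int_def conj_commute)
    have L: "set L \<subseteq> {..<n}" "length L = k" using that(2) by auto
    have "L ! l < n" if "l < k" for l
      using subsetD[OF L(1) nth_mem[of l L]] L(2) that by simp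
    then have "(\<lambda>\<omega>. \<lambda>l\<in>{..<k}. X (L ! l) T \<omega>) \<in> M \<rightarrow>\<^sub>M PiM {..<k} (\<lambda>_. \<nu>)"
      using T_pos by (intro measurable_restrict X_measurable) auto
    from measurable_sets[OF this A_sets]
    show "{\<omega> \<in> space M. (\<lambda>l\<in>{..<k}. X (L ! l) T \<omega>) \<in> A} \<in> sets M"
      by (simp add: vimage_def Int_def conj_commute)
  qed
  have fin: "finite {(own, L). own \<in> owners n \<and> L \<in> ?L \<and> map (?size own) L = c}"
    by (rule finite_subset[of _ "owners n \<times> ?L"]) (auto simp: finite_owners finite_lists_length_eq)
  have "(\<Union>q\<in>{(own, L). own \<in> owners n \<and> L \<in> ?L \<and> map (?size own) L = c}. ?E (fst q) (snd q)) \<in> sets M"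
  proof (rule sets.finite_UN[OF fin])
    fix q assume "q \<in> {(own, L). own \<in> owners n \<and> L \<in> ?L \<and> map (?size own) L = c}"
    then have "fst q \<in> owners n" "snd q \<in> ?L" by (simp_all add: case_prod_beta)
    then show "?E (fst q) (snd q) \<in> sets M" by (rule E_sets)
  qed
  also have "(\<Union>q\<in>{(own, L). own \<in> owners n \<and> L \<in> ?L \<and> map (?size own) L = c}. ?E (fst q) (snd q)) =
    coalescence_event pr"
  proof (intro equalityI subsetI)
    have surv: "survivors T n pr X \<omega> = ?sorted (final_own T n pr X \<omega>) \<omega>" for \<omega>
    proof -
      have "final_own T n pr X \<omega> \<in> owners n" unfolding final_own_def by (rule funpow_collide_owners[OF id_owners])
      then show ?thesis
        unfolding survivors_def by (intro sort_key_cong) (auto simp: f_def owners_def)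
    qed
    fix \<omega>
    {
      assume "\<omega> \<in> (\<Union>q\<in>{(own, L). own \<in> owners n \<and> L \<in> ?L \<and> map (?size own) L = c}. ?E (fst q) (snd q))"
      then obtain own L where *: "map (?size own) L = c" "\<omega> \<in> ?E own L" "length L = k" by auto
      then have "final_own T n pr X \<omega> = own" "?sorted own \<omega> = L" by blast+
      then have "survivors T n pr X \<omega> = L" using surv[of \<omega>] by (simp only:)
      with * show "\<omega> \<in> coalescence_event pr"
        by (simp add: coalescence_event_def coalescence_pattern_def survivor_positions_def)
    }
    assume \<omega>: "\<omega> \<in> coalescence_event pr"
    define own L where "own = final_own T n pr X \<omega>" and "L = survivors T n pr X \<omega>"
    have own: "own \<in> owners n"
      unfolding own_def final_own_def by (rule funpow_collide_owners[OF id_owners])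
    have sorted: "?sorted own \<omega> = L" unfolding own_def L_def by (rule surv[symmetric])
    have size: "map (?size own) L = c"
      using \<omega> unfolding coalescence_event_def coalescence_pattern_def own_def L_def by simp
    have len: "length L = k" unfolding size[symmetric] by simp
    have "set L = own ` {..<n}" unfolding sorted[symmetric] by simp
    then have "L \<in> ?L" using owners_image[OF own] len by simp
    then have "(own, L) \<in> {(own, L). own \<in> owners n \<and> L \<in> ?L \<and> map (?size own) L = c}"
      using own size by blast
    moreover have "(\<lambda>l\<in>{..<k}. X (L ! l) T \<omega>) \<in> A"
      using \<omega> len by (simp add: coalescence_event_def survivor_positions_def L_def)
    then have "\<omega> \<in> ?E (fst (own, L)) (snd (own, L))"
      using \<omega> sorted own_def unfolding coalescence_event_def by simp
    ultimately show "\<omega> \<in> (\<Union>q\<in>{(own, L). own \<in> owners n \<and> L \<in> ?L \<and> map (?size own) L = c}. ?E (fst q) (snd q))"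
      by (rule UN_I)
  qed
  finally show ?thesis .
qed

lemma prob_coalescence_event:
  assumes pr: "inj_on pr {..<n}" and A: "A \<subseteq> weyl_chamber \<nu> k"
  shows "prob (coalescence_event pr) = (\<integral>\<omega>. final_sum id \<omega> \<partial>M)"
proof -
  have "AE \<omega> in M. final_sum (final_own T n pr X \<omega>) \<omega> = indicator (coalescence_event pr) \<omega>"
    using AE_ordered AE_space
  proof eventually_elim
    case (elim \<omega>)
    then interpret ordered_trajectories T n X \<omega> by simp
    let ?own = "final_own T n pr X \<omega>"
    \<comment> \<open>Final owners increase with the index, and distinct final owners never meet and
      so keep their order; this is the monotonicity that \<open>coalescence_sum_mono\<close> asks
      for.\<close>
    have le: "X (?own i) T \<omega> \<le> X (?own j) T \<omega>" if "i \<le> j" "j < n" for i j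
    proof (cases "?own i = ?own j")
      case False
      then have "?own i < ?own j" using final_own_mono[OF pr that] by simp
      then show ?thesis using that by (intro less_imp_le final_own_separated[OF pr]) auto
    qed simp
    have "final_sum ?own \<omega> =
      of_bool ((\<lambda>l\<in>{..<k}. X (?own (start l)) T \<omega>) \<in> A \<and> (\<forall>j<n. X (?own j) T \<omega> = X (?own (head j)) T \<omega>))"
      unfolding final_sum_def by (rule coalescence_sum_mono[OF A le])
    also have "(\<lambda>l\<in>{..<k}. X (?own (start l)) T \<omega>) \<in> A \<and> (\<forall>j<n. X (?own j) T \<omega> = X (?own (head j)) T \<omega>) \<longleftrightarrow>
      \<omega> \<in> coalescence_event pr"
      using pattern_iff[where own = ?own and z = "\<lambda>I. X I T \<omega>", OF A final_own_mono[OF pr] final_own_separated[OF pr]] elim(2)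
      by (simp add: coalescence_event_def coalescence_pattern_def survivor_positions_def survivors_def)
    finally show ?case by (simp add: indicator_def)
  qed
  then have "(\<integral>\<omega>. final_sum (final_own T n pr X \<omega>) \<omega> \<partial>M) = (\<integral>\<omega>. indicator (coalescence_event pr) \<omega> \<partial>M)"
    using coalescence_event_sets by (intro integral_cong_AE final_sum_final_own_measurable) auto
  then show ?thesis
    using coalescence_event_sets by (simp add: expectation_final_own)
qed

end

theorem theorem11p2:
  fixes M :: "'w measure" and \<nu> :: "real measure"
    and K :: "real \<Rightarrow> real \<Rightarrow> real \<Rightarrow> real measure"
    and X :: "nat \<Rightarrow> real \<Rightarrow> 'w \<Rightarrow> real"
    and P :: "real \<Rightarrow> real measure" and p :: "real \<Rightarrow> real \<Rightarrow> real"
    and x :: "nat \<Rightarrow> real" and T :: real and n :: nat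
    and pr :: "nat \<Rightarrow> nat" and c :: "nat list" and A :: "(nat \<Rightarrow> real) set"
  defines "P \<equiv> K 0 T"
  assumes "prob_space M"
    and state_space: "\<nu> = lborel \<or> \<nu> = count_space \<int>"
    and "T > 0"
    and process: "transition_kernels \<nu> T K"
    and start: "\<forall>i<n. x i \<in> space \<nu>" "\<forall>i j. i \<le> j \<and> j < n \<longrightarrow> x i \<le> x j"
    and KM: "KM1 M \<nu> T n K X" "KM2 M \<nu> T n K x X" "KM3 M T n X" "KM4 M \<nu> T n X"
    and density: "\<forall>i<n. p (x i) \<in> borel_measurable \<nu> \<and> (\<forall>y\<in>space \<nu>. 0 \<le> p (x i) y) \<and>
                     P (x i) = density \<nu> (\<lambda>y. ennreal (p (x i) y))"
    and priority: "inj_on pr {..<n}"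
    and composition: "is_composition c n"
    and A: "A \<in> sets (PiM {..<length c} (\<lambda>_. \<nu>))" "A \<subseteq> weyl_chamber \<nu> (length c)"
  shows "measure M {\<omega>\<in>space M. coalescence_pattern T n pr X \<omega> = c \<and>
                                survivor_positions T n pr X \<omega> \<in> A}
         = (LINT y:A | PiM {..<length c} (\<lambda>_. \<nu>). Determinant.det (coalescence_matrix \<nu> P p n c x y))"
proof -
  interpret C: coalescing_particles M \<nu> T n K x X c A
  proof (intro coalescing_particles.intro karlin_mcgregor.intro karlin_mcgregor_axioms.intro
      composition.intro coalescing_particles_axioms.intro)
    show "x i \<in> space \<nu>" if "i < n" for i using start(1) that by blast
  qed (fact assms)+
  have "measure M {\<omega>\<in>space M. coalescence_pattern T n pr X \<omega> = c \<and> survivor_positions T n pr X \<omega> \<in> A} =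
      (\<integral>\<omega>. C.final_sum id \<omega> \<partial>M)"
    using C.prob_coalescence_event[OF priority A(2)] unfolding C.coalescence_event_def .
  also have "\<dots> = (LINT y:A | PiM {..<length c} (\<lambda>_. \<nu>).
      Determinant.det (coalescence_matrix \<nu> P p n c x y))"
    using density unfolding P_def by (intro C.expectation_final_sum_id) auto
  finally show ?thesis .
qed

end
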